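(* Let $\mathfrak Z=(\mathcal Z,(L_A,R_A),(L_B,R_B))$ be a double adjunction on categories $\mathcal X$ and $\mathcal Y$. Then the pair $(R_A,R_B)$ is moritable if and only if the following hold: $\mathcal Z$ has colimits of all the diagrams $\Delta(\mathbf X)$, for all objects $\mathbf X$ of $(\mathcal X,\mathcal Y)^{\mathbb T}$, and the pair $(R_A,R_B)$ reflects isomorphisms and converts colimits into coequalisers.
   Context: Composition of functors is written by juxtaposition; $\circ$ is composition of morphisms/natural transformations; the identity of an object is denoted by the object. A double adjunction $(\mathcal Z,(L_A,R_A),(L_B,R_B))$ on $\mathcal X,\mathcal Y$ is a category $\mathcal Z$ with adjunctions $(L_A:\mathcal X\to\mathcal Z,\ R_A:\mathcal Z\to\mathcal X)$ and $(L_B:\mathcal Y\to\mathcal Z,\ R_B:\mathcal Z\to\mathcal Y)$ (left adjoints listed first), with units $\eta^A,\eta^B$ and counits $\varepsilon^A,\varepsilon^B$. The Eilenberg-Moore category $(\mathcal X,\mathcal Y)^{\mathbb T}$ of the associated Morita context $\mathbb T$ has as objects $\mathbf X=((X,\rho^X),(Y,\rho^Y),v,w)$, where $(X,\rho^X:R_AL_AX\to X)$ is an algebra of the monad $(R_AL_A,R_A\varepsilon^AL_A,\eta^A)$ on $\mathcal X$, $(Y,\rho^Y:R_BL_BY\to Y)$ is an algebra of the monad $(R_BL_B,R_B\varepsilon^BL_B,\eta^B)$ on $\mathcal Y$, and $v:R_AL_BY\to X$ in $\mathcal X$, $w:R_BL_AX\to Y$ in $\mathcal Y$ satisfy $v\circ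 R_A\varepsilon^AL_BY=\rho^X\circ R_AL_Av$, $w\circ R_B\varepsilon^BL_AX=\rho^Y\circ R_BL_Bw$, $v\circ R_AL_Bw=\rho^X\circ R_A\varepsilon^BL_AX$, $w\circ R_BL_Av=\rho^Y\circ R_B\varepsilon^AL_BY$, $w\circ R_BL_A\rho^X=w\circ R_B\varepsilon^AL_AX$, $v\circ R_AL_B\rho^Y=v\circ R_A\varepsilon^BL_BY$. Morphisms $\mathbf X\to\mathbf X'$ are pairs $(f,g)$ of algebra morphisms $f:X\to X'$, $g:Y\to Y'$ with $g\circ w=w'\circ R_BL_Af$ and $f\circ v=v'\circ R_AL_Bg$. The comparison functor $K:\mathcal Z\to(\mathcal X,\mathcal Y)^{\mathbb T}$ is $KZ=((R_AZ,R_A\varepsilon^AZ),(R_BZ,R_B\varepsilon^BZ),R_A\varepsilon^BZ,R_B\varepsilon^AZ)$, $Kf=(R_Af,R_Bf)$. The pair $(R_A,R_B)$ is moritable if $K$ is an equivalence of categories. It reflects isomorphisms if every morphism $f$ of $\mathcal Z$ with both $R_Af$ and $R_Bf$ isomorphisms is an isomorphism. For $\mathbf X=((X,\rho^X),(Y,\rho^Y),v,w)$, $\Delta(\mathbf X)$ is the diagram in $\mathcal Z$ with six objects $L_AR_AL_AX$, $L_BR_BL_AX$, $L_AR_AL_BY$, $L_BR_BL_BY$, $L_AX$, $L_BY$ and arrows $L_A\rho^X,\ \varepsilon^AL_AX:L_AR_AL_AX\rightrightarrows L_AX$; $\varepsilon^BL_AX:L_BR_BL_AX\to L_AX$; $L_Bw:L_BR_BL_AX\to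 L_BY$; $\varepsilon^AL_BY:L_AR_AL_BY\to L_BY$; $L_Av:L_AR_AL_BY\to L_AX$; $\varepsilon^BL_BY,\ L_B\rho^Y:L_BR_BL_BY\rightrightarrows L_BY$. Its colimit (when it exists) is denoted $(D\mathbf X,\ d^A\mathbf X:L_AX\to D\mathbf X,\ d^B\mathbf X:L_BY\to D\mathbf X)$. When these colimits exist, $(R_A,R_B)$ is said to convert colimits into coequalisers if for all $\mathbf X$ the morphism $R_Ad^A\mathbf X:R_AL_AX\to R_AD\mathbf X$ is a coequaliser in $\mathcal X$ of $R_AL_A\rho^X,\ R_A\varepsilon^AL_AX:R_AL_AR_AL_AX\rightrightarrows R_AL_AX$, and $R_Bd^B\mathbf X:R_BL_BY\to R_BD\mathbf X$ is a coequaliser in $\mathcal Y$ of $R_BL_B\rho^Y,\ R_B\varepsilon^BL_BY:R_BL_BR_BL_BY\rightrightarrows R_BL_BY$. *)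

theory Defs
  imports Main
begin

text \<open>All conditions are relativised to the carriers \<open>Ob\<close> and \<open>Mor\<close>; values of the operations
  outside of the carriers, or on non-composable pairs, are irrelevant.\<close>

record ('o, 'm) category =
  Ob :: "'o set"
  Mor :: "'m set"
  Dom :: "'m \<Rightarrow> 'o"
  Cod :: "'m \<Rightarrow> 'o"
  Id :: "'o \<Rightarrow> 'm"
  Comp :: "'m \<Rightarrow> 'm \<Rightarrow> 'm"  (infixl "\<odot>\<index>" 70)

definition hom :: "('o, 'm) category \<Rightarrow> 'o \<Rightarrow> 'o \<Rightarrow> 'm set" where
  "hom C a b = {f \<in> Mor C. Dom C f = a \<and> Cod C f = b}"

locale category =
  fixes C :: "('o, 'm) category" (structure)
  assumes Dom_in: "f \<in> Mor C \<Longrightarrow> Dom C f \<in> Ob C"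
    and Cod_in: "f \<in> Mor C \<Longrightarrow> Cod C f \<in> Ob C"
    and Id_in: "a \<in> Ob C \<Longrightarrow> Id C a \<in> hom C a a"
    and Comp_in: "\<lbrakk>f \<in> hom C a b; g \<in> hom C b c\<rbrakk> \<Longrightarrow> g \<odot> f \<in> hom C a c"
    and Comp_Id_left: "f \<in> hom C a b \<Longrightarrow> Id C b \<odot> f = f"
    and Comp_Id_right: "f \<in> hom C a b \<Longrightarrow> f \<odot> Id C a = f"
    and Comp_assoc: "\<lbrakk>f \<in> hom C a b; g \<in> hom C b c; h \<in> hom C c d\<rbrakk>
      \<Longrightarrow> h \<odot> g \<odot> f = h \<odot> (g \<odot> f)"

definition is_iso :: "('o, 'm) category \<Rightarrow> 'm \<Rightarrow> bool" where
  "is_iso C f \<longleftrightarrow> f \<in> Mor C \<and>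
     (\<exists>g \<in> hom C (Cod C f) (Dom C f).
        g \<odot>\<^bsub>C\<^esub> f = Id C (Dom C f) \<and> f \<odot>\<^bsub>C\<^esub> g = Id C (Cod C f))"

record ('o, 'm, 'p, 'n) cfunctor =
  fob :: "'o \<Rightarrow> 'p"  (infixr "\<cdot>\<^sub>o" 90)
  fmor :: "'m \<Rightarrow> 'n"  (infixr "\<cdot>\<^sub>m" 90)

locale cfunctor = dom: category C + cod: category D
  for C :: "('o, 'm) category" and D :: "('p, 'n) category" +
  fixes F :: "('o, 'm, 'p, 'n) cfunctor"
  assumes fob_in: "a \<in> Ob C \<Longrightarrow> F \<cdot>\<^sub>o a \<in> Ob D"
    and fmor_in: "f \<in> hom C a b \<Longrightarrow> F \<cdot>\<^sub>m f \<in> hom D (F \<cdot>\<^sub>o a) (F \<cdot>\<^sub>o b)"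
    and fmor_Id: "a \<in> Ob C \<Longrightarrow> F \<cdot>\<^sub>m Id C a = Id D (F \<cdot>\<^sub>o a)"
    and fmor_Comp: "\<lbrakk>f \<in> hom C a b; g \<in> hom C b c\<rbrakk>
      \<Longrightarrow> F \<cdot>\<^sub>m (g \<odot>\<^bsub>C\<^esub> f) = F \<cdot>\<^sub>m g \<odot>\<^bsub>D\<^esub> F \<cdot>\<^sub>m f"

definition id_functor :: "('o, 'm, 'o, 'm) cfunctor" where
  "id_functor = \<lparr>fob = (\<lambda>a. a), fmor = (\<lambda>f. f)\<rparr>"

definition comp_functor ::
  "('p, 'n, 'q, 'k) cfunctor \<Rightarrow> ('o, 'm, 'p, 'n) cfunctor \<Rightarrow> ('o, 'm, 'q, 'k) cfunctor" where
  "comp_functor G F = \<lparr>fob = (\<lambda>a. G \<cdot>\<^sub>o F \<cdot>\<^sub>o a), fmor = (\<lambda>f. G \<cdot>\<^sub>m F \<cdot>\<^sub>m f)\<rparr>"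

locale nat_trans = source: cfunctor C D F + target: cfunctor C D G
  for C :: "('o, 'm) category" and D :: "('p, 'n) category"
    and F :: "('o, 'm, 'p, 'n) cfunctor" and G :: "('o, 'm, 'p, 'n) cfunctor" +
  fixes \<tau> :: "'o \<Rightarrow> 'n"
  assumes component_in: "a \<in> Ob C \<Longrightarrow> \<tau> a \<in> hom D (F \<cdot>\<^sub>o a) (G \<cdot>\<^sub>o a)"
    and naturality: "f \<in> hom C a b \<Longrightarrow> \<tau> b \<odot>\<^bsub>D\<^esub> F \<cdot>\<^sub>m f = G \<cdot>\<^sub>m f \<odot>\<^bsub>D\<^esub> \<tau> a"

definition naturally_isomorphic ::
  "('o, 'm) category \<Rightarrow> ('p, 'n) category \<Rightarrow> ('o, 'm, 'p, 'n) cfunctor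
    \<Rightarrow> ('o, 'm, 'p, 'n) cfunctor \<Rightarrow> bool" where
  "naturally_isomorphic C D F G \<longleftrightarrow>
     (\<exists>\<tau>. nat_trans C D F G \<tau> \<and> (\<forall>a \<in> Ob C. is_iso D (\<tau> a)))"

definition is_equivalence ::
  "('o, 'm) category \<Rightarrow> ('p, 'n) category \<Rightarrow> ('o, 'm, 'p, 'n) cfunctor \<Rightarrow> bool" where
  "is_equivalence C D F \<longleftrightarrow> cfunctor C D F \<and>
     (\<exists>G. cfunctor D C G \<and>
        naturally_isomorphic C C (comp_functor G F) id_functor \<and>
        naturally_isomorphic D D (comp_functor F G) id_functor)"

definition is_coequaliser :: "('o, 'm) category \<Rightarrow> 'm \<Rightarrow> 'm \<Rightarrow> 'm \<Rightarrow> bool" where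
  "is_coequaliser C f g e \<longleftrightarrow>
     (\<exists>a b c. f \<in> hom C a b \<and> g \<in> hom C a b \<and> e \<in> hom C b c \<and>
        e \<odot>\<^bsub>C\<^esub> f = e \<odot>\<^bsub>C\<^esub> g \<and>
        (\<forall>c'. \<forall>e' \<in> hom C b c'. e' \<odot>\<^bsub>C\<^esub> f = e' \<odot>\<^bsub>C\<^esub> g
           \<longrightarrow> (\<exists>!h. h \<in> hom C c c' \<and> h \<odot>\<^bsub>C\<^esub> e = e')))"

text \<open>Diagrams indexed by a directed graph; no commutativity is imposed.\<close>

record ('v, 'e, 'o, 'm) diagram =
  Vert :: "'v set"
  Edge :: "'e set"
  src :: "'e \<Rightarrow> 'v"
  tgt :: "'e \<Rightarrow> 'v"
  vob :: "'v \<Rightarrow> 'o"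
  emor :: "'e \<Rightarrow> 'm"

definition is_cocone ::
  "('o, 'm) category \<Rightarrow> ('v, 'e, 'o, 'm) diagram \<Rightarrow> 'o \<Rightarrow> ('v \<Rightarrow> 'm) \<Rightarrow> bool" where
  "is_cocone C \<Delta> D d \<longleftrightarrow> D \<in> Ob C \<and>
     (\<forall>i \<in> Vert \<Delta>. d i \<in> hom C (vob \<Delta> i) D) \<and>
     (\<forall>e \<in> Edge \<Delta>. d (tgt \<Delta> e) \<odot>\<^bsub>C\<^esub> emor \<Delta> e = d (src \<Delta> e))"

definition is_colimit ::
  "('o, 'm) category \<Rightarrow> ('v, 'e, 'o, 'm) diagram \<Rightarrow> 'o \<Rightarrow> ('v \<Rightarrow> 'm) \<Rightarrow> bool" where
  "is_colimit C \<Delta> D d \<longleftrightarrow> is_cocone C \<Delta> D d \<and>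
     (\<forall>D' d'. is_cocone C \<Delta> D' d' \<longrightarrow>
        (\<exists>!h. h \<in> hom C D D' \<and> (\<forall>i \<in> Vert \<Delta>. h \<odot>\<^bsub>C\<^esub> d i = d' i)))"

record ('xo, 'xm, 'zo, 'zm) adj =
  left :: "('xo, 'xm, 'zo, 'zm) cfunctor"  ("L\<index>")
  right :: "('zo, 'zm, 'xo, 'xm) cfunctor"  ("R\<index>")
  unit :: "'xo \<Rightarrow> 'xm"  ("\<eta>\<index>")
  counit :: "'zo \<Rightarrow> 'zm"  ("\<epsilon>\<index>")

locale adjunction =
  left: cfunctor \<X> \<Z> "L\<^bsub>A\<^esub>" + right: cfunctor \<Z> \<X> "R\<^bsub>A\<^esub>" +
  unit: nat_trans \<X> \<X> id_functor "comp_functor R\<^bsub>A\<^esub> L\<^bsub>A\<^esub>" "\<eta>\<^bsub>A\<^esub>" +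
  counit: nat_trans \<Z> \<Z> "comp_functor L\<^bsub>A\<^esub> R\<^bsub>A\<^esub>" id_functor "\<epsilon>\<^bsub>A\<^esub>"
  for \<X> :: "('xo, 'xm) category" and \<Z> :: "('zo, 'zm) category"
    and A :: "('xo, 'xm, 'zo, 'zm) adj" +
  assumes triangle_left:
      "x \<in> Ob \<X> \<Longrightarrow> \<epsilon>\<^bsub>A\<^esub> (L\<^bsub>A\<^esub> \<cdot>\<^sub>o x) \<odot>\<^bsub>\<Z>\<^esub> L\<^bsub>A\<^esub> \<cdot>\<^sub>m \<eta>\<^bsub>A\<^esub> x = Id \<Z> (L\<^bsub>A\<^esub> \<cdot>\<^sub>o x)"
    and triangle_right:
      "z \<in> Ob \<Z> \<Longrightarrow> R\<^bsub>A\<^esub> \<cdot>\<^sub>m \<epsilon>\<^bsub>A\<^esub> z \<odot>\<^bsub>\<X>\<^esub> \<eta>\<^bsub>A\<^esub> (R\<^bsub>A\<^esub> \<cdot>\<^sub>o z) = Id \<X> (R\<^bsub>A\<^esub> \<cdot>\<^sub>o z)"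

locale double_adjunction =
  adjA: adjunction \<X> \<Z> A + adjB: adjunction \<Y> \<Z> B
  for \<X> :: "('xo, 'xm) category" and \<Y> :: "('yo, 'ym) category"
    and \<Z> :: "('zo, 'zm) category"
    and A :: "('xo, 'xm, 'zo, 'zm) adj" and B :: "('yo, 'ym, 'zo, 'zm) adj"

record ('o, 'm) monad =
  mfun :: "('o, 'm, 'o, 'm) cfunctor"
  mmult :: "'o \<Rightarrow> 'm"
  munit :: "'o \<Rightarrow> 'm"

definition adj_monad :: "('xo, 'xm, 'zo, 'zm) adj \<Rightarrow> ('xo, 'xm) monad" where
  "adj_monad A = \<lparr>mfun = comp_functor R\<^bsub>A\<^esub> L\<^bsub>A\<^esub>,
     mmult = (\<lambda>x. R\<^bsub>A\<^esub> \<cdot>\<^sub>m \<epsilon>\<^bsub>A\<^esub> (L\<^bsub>A\<^esub> \<cdot>\<^sub>o x)), munit = \<eta>\<^bsub>A\<^esub>\<rparr>"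

definition is_algebra :: "('o, 'm) category \<Rightarrow> ('o, 'm) monad \<Rightarrow> 'o \<times> 'm \<Rightarrow> bool" where
  "is_algebra C T = (\<lambda>(x, \<rho>). x \<in> Ob C \<and> \<rho> \<in> hom C (mfun T \<cdot>\<^sub>o x) x \<and>
     \<rho> \<odot>\<^bsub>C\<^esub> mfun T \<cdot>\<^sub>m \<rho> = \<rho> \<odot>\<^bsub>C\<^esub> mmult T x \<and>
     \<rho> \<odot>\<^bsub>C\<^esub> munit T x = Id C x)"

definition alg_hom ::
  "('o, 'm) category \<Rightarrow> ('o, 'm) monad \<Rightarrow> 'o \<times> 'm \<Rightarrow> 'o \<times> 'm \<Rightarrow> 'm set" where
  "alg_hom C T = (\<lambda>(x, \<rho>) (x', \<rho>').
     {f \<in> hom C x x'. f \<odot>\<^bsub>C\<^esub> \<rho> = \<rho>' \<odot>\<^bsub>C\<^esub> mfun T \<cdot>\<^sub>m f})"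

type_synonym ('xo, 'xm, 'yo, 'ym) em_ob =
  "('xo \<times> 'xm) \<times> ('yo \<times> 'ym) \<times> 'xm \<times> 'ym"

definition EM_Ob ::
  "('xo, 'xm) category \<Rightarrow> ('yo, 'ym) category
    \<Rightarrow> ('xo, 'xm, 'zo, 'zm) adj \<Rightarrow> ('yo, 'ym, 'zo, 'zm) adj
    \<Rightarrow> ('xo, 'xm, 'yo, 'ym) em_ob set" where
  "EM_Ob \<X> \<Y> A B = {((x, \<rho>), (y, \<sigma>), v, w).
     is_algebra \<X> (adj_monad A) (x, \<rho>) \<and>
     is_algebra \<Y> (adj_monad B) (y, \<sigma>) \<and>
     v \<in> hom \<X> (R\<^bsub>A\<^esub> \<cdot>\<^sub>o L\<^bsub>B\<^esub> \<cdot>\<^sub>o y) x \<and>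
     w \<in> hom \<Y> (R\<^bsub>B\<^esub> \<cdot>\<^sub>o L\<^bsub>A\<^esub> \<cdot>\<^sub>o x) y \<and>
     v \<odot>\<^bsub>\<X>\<^esub> R\<^bsub>A\<^esub> \<cdot>\<^sub>m \<epsilon>\<^bsub>A\<^esub> (L\<^bsub>B\<^esub> \<cdot>\<^sub>o y) = \<rho> \<odot>\<^bsub>\<X>\<^esub> R\<^bsub>A\<^esub> \<cdot>\<^sub>m L\<^bsub>A\<^esub> \<cdot>\<^sub>m v \<and>
     w \<odot>\<^bsub>\<Y>\<^esub> R\<^bsub>B\<^esub> \<cdot>\<^sub>m \<epsilon>\<^bsub>B\<^esub> (L\<^bsub>A\<^esub> \<cdot>\<^sub>o x) = \<sigma> \<odot>\<^bsub>\<Y>\<^esub> R\<^bsub>B\<^esub> \<cdot>\<^sub>m L\<^bsub>B\<^esub> \<cdot>\<^sub>m w \<and>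
     v \<odot>\<^bsub>\<X>\<^esub> R\<^bsub>A\<^esub> \<cdot>\<^sub>m L\<^bsub>B\<^esub> \<cdot>\<^sub>m w = \<rho> \<odot>\<^bsub>\<X>\<^esub> R\<^bsub>A\<^esub> \<cdot>\<^sub>m \<epsilon>\<^bsub>B\<^esub> (L\<^bsub>A\<^esub> \<cdot>\<^sub>o x) \<and>
     w \<odot>\<^bsub>\<Y>\<^esub> R\<^bsub>B\<^esub> \<cdot>\<^sub>m L\<^bsub>A\<^esub> \<cdot>\<^sub>m v = \<sigma> \<odot>\<^bsub>\<Y>\<^esub> R\<^bsub>B\<^esub> \<cdot>\<^sub>m \<epsilon>\<^bsub>A\<^esub> (L\<^bsub>B\<^esub> \<cdot>\<^sub>o y) \<and>
     w \<odot>\<^bsub>\<Y>\<^esub> R\<^bsub>B\<^esub> \<cdot>\<^sub>m L\<^bsub>A\<^esub> \<cdot>\<^sub>m \<rho> = w \<odot>\<^bsub>\<Y>\<^esub> R\<^bsub>B\<^esub> \<cdot>\<^sub>m \<epsilon>\<^bsub>A\<^esub> (L\<^bsub>A\<^esub> \<cdot>\<^sub>o x) \<and>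
     v \<odot>\<^bsub>\<X>\<^esub> R\<^bsub>A\<^esub> \<cdot>\<^sub>m L\<^bsub>B\<^esub> \<cdot>\<^sub>m \<sigma> = v \<odot>\<^bsub>\<X>\<^esub> R\<^bsub>A\<^esub> \<cdot>\<^sub>m \<epsilon>\<^bsub>B\<^esub> (L\<^bsub>B\<^esub> \<cdot>\<^sub>o y)}"

definition EM_hom ::
  "('xo, 'xm) category \<Rightarrow> ('yo, 'ym) category
    \<Rightarrow> ('xo, 'xm, 'zo, 'zm) adj \<Rightarrow> ('yo, 'ym, 'zo, 'zm) adj
    \<Rightarrow> ('xo, 'xm, 'yo, 'ym) em_ob \<Rightarrow> ('xo, 'xm, 'yo, 'ym) em_ob \<Rightarrow> ('xm \<times> 'ym) set" where
  "EM_hom \<X> \<Y> A B = (\<lambda>(a, b, v, w) (a', b', v', w').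
     {(f, g). f \<in> alg_hom \<X> (adj_monad A) a a' \<and> g \<in> alg_hom \<Y> (adj_monad B) b b' \<and>
        g \<odot>\<^bsub>\<Y>\<^esub> w = w' \<odot>\<^bsub>\<Y>\<^esub> R\<^bsub>B\<^esub> \<cdot>\<^sub>m L\<^bsub>A\<^esub> \<cdot>\<^sub>m f \<and>
        f \<odot>\<^bsub>\<X>\<^esub> v = v' \<odot>\<^bsub>\<X>\<^esub> R\<^bsub>A\<^esub> \<cdot>\<^sub>m L\<^bsub>B\<^esub> \<cdot>\<^sub>m g})"

text \<open>A morphism is stored together with its source and target, since the pair \<open>(f, g)\<close> alone does
  not determine the structure maps of either.\<close>

definition EM ::
  "('xo, 'xm) category \<Rightarrow> ('yo, 'ym) category
    \<Rightarrow> ('xo, 'xm, 'zo, 'zm) adj \<Rightarrow> ('yo, 'ym, 'zo, 'zm) adj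
    \<Rightarrow> (('xo, 'xm, 'yo, 'ym) em_ob,
        ('xo, 'xm, 'yo, 'ym) em_ob \<times> ('xo, 'xm, 'yo, 'ym) em_ob \<times> ('xm \<times> 'ym)) category" where
  "EM \<X> \<Y> A B = \<lparr>
     Ob = EM_Ob \<X> \<Y> A B,
     Mor = {(p, q, h). p \<in> EM_Ob \<X> \<Y> A B \<and> q \<in> EM_Ob \<X> \<Y> A B \<and> h \<in> EM_hom \<X> \<Y> A B p q},
     Dom = (\<lambda>(p, q, h). p),
     Cod = (\<lambda>(p, q, h). q),
     Id = (\<lambda>p. case p of ((x, \<rho>), (y, \<sigma>), v, w) \<Rightarrow> (p, p, (Id \<X> x, Id \<Y> y))),
     Comp = (\<lambda>(q, r, (f', g')) (p, q', (f, g)). (p, r, (f' \<odot>\<^bsub>\<X>\<^esub> f, g' \<odot>\<^bsub>\<Y>\<^esub> g)))\<rparr>"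

definition comparison_ob ::
  "('xo, 'xm, 'zo, 'zm) adj \<Rightarrow> ('yo, 'ym, 'zo, 'zm) adj \<Rightarrow> 'zo \<Rightarrow> ('xo, 'xm, 'yo, 'ym) em_ob" where
  "comparison_ob A B z =
     ((R\<^bsub>A\<^esub> \<cdot>\<^sub>o z, R\<^bsub>A\<^esub> \<cdot>\<^sub>m \<epsilon>\<^bsub>A\<^esub> z), (R\<^bsub>B\<^esub> \<cdot>\<^sub>o z, R\<^bsub>B\<^esub> \<cdot>\<^sub>m \<epsilon>\<^bsub>B\<^esub> z), R\<^bsub>A\<^esub> \<cdot>\<^sub>m \<epsilon>\<^bsub>B\<^esub> z, R\<^bsub>B\<^esub> \<cdot>\<^sub>m \<epsilon>\<^bsub>A\<^esub> z)"

definition comparison ::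
  "('zo, 'zm) category \<Rightarrow> ('xo, 'xm, 'zo, 'zm) adj \<Rightarrow> ('yo, 'ym, 'zo, 'zm) adj
    \<Rightarrow> ('zo, 'zm, ('xo, 'xm, 'yo, 'ym) em_ob,
        ('xo, 'xm, 'yo, 'ym) em_ob \<times> ('xo, 'xm, 'yo, 'ym) em_ob \<times> ('xm \<times> 'ym)) cfunctor" where
  "comparison \<Z> A B = \<lparr>
     fob = comparison_ob A B,
     fmor = (\<lambda>f. (comparison_ob A B (Dom \<Z> f), comparison_ob A B (Cod \<Z> f),
                  (R\<^bsub>A\<^esub> \<cdot>\<^sub>m f, R\<^bsub>B\<^esub> \<cdot>\<^sub>m f)))\<rparr>"

definition moritable ::
  "('xo, 'xm) category \<Rightarrow> ('yo, 'ym) category \<Rightarrow> ('zo, 'zm) category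
    \<Rightarrow> ('xo, 'xm, 'zo, 'zm) adj \<Rightarrow> ('yo, 'ym, 'zo, 'zm) adj \<Rightarrow> bool" where
  "moritable \<X> \<Y> \<Z> A B \<longleftrightarrow> is_equivalence \<Z> (EM \<X> \<Y> A B) (comparison \<Z> A B)"

definition reflects_isos ::
  "('xo, 'xm) category \<Rightarrow> ('yo, 'ym) category \<Rightarrow> ('zo, 'zm) category
    \<Rightarrow> ('xo, 'xm, 'zo, 'zm) adj \<Rightarrow> ('yo, 'ym, 'zo, 'zm) adj \<Rightarrow> bool" where
  "reflects_isos \<X> \<Y> \<Z> A B \<longleftrightarrow>
     (\<forall>f \<in> Mor \<Z>. is_iso \<X> (R\<^bsub>A\<^esub> \<cdot>\<^sub>m f) \<and> is_iso \<Y> (R\<^bsub>B\<^esub> \<cdot>\<^sub>m f) \<longrightarrow> is_iso \<Z> f)"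

datatype delta_vert = V_LRL_AA | V_LRL_BA | V_LRL_AB | V_LRL_BB | V_LA | V_LB

datatype delta_edge = E_LA_rho | E_epsA_LA | E_epsB_LA | E_LB_w
  | E_epsA_LB | E_LA_v | E_epsB_LB | E_LB_rho

definition Delta ::
  "('xo, 'xm, 'zo, 'zm) adj \<Rightarrow> ('yo, 'ym, 'zo, 'zm) adj \<Rightarrow> ('xo, 'xm, 'yo, 'ym) em_ob
    \<Rightarrow> (delta_vert, delta_edge, 'zo, 'zm) diagram" where
  "Delta A B = (\<lambda>((x, \<rho>), (y, \<sigma>), v, w). \<lparr>
     Vert = UNIV,
     Edge = UNIV,
     src = (\<lambda>e. case e of
         E_LA_rho \<Rightarrow> V_LRL_AA | E_epsA_LA \<Rightarrow> V_LRL_AA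
       | E_epsB_LA \<Rightarrow> V_LRL_BA | E_LB_w \<Rightarrow> V_LRL_BA
       | E_epsA_LB \<Rightarrow> V_LRL_AB | E_LA_v \<Rightarrow> V_LRL_AB
       | E_epsB_LB \<Rightarrow> V_LRL_BB | E_LB_rho \<Rightarrow> V_LRL_BB),
     tgt = (\<lambda>e. case e of
         E_LA_rho \<Rightarrow> V_LA | E_epsA_LA \<Rightarrow> V_LA
       | E_epsB_LA \<Rightarrow> V_LA | E_LB_w \<Rightarrow> V_LB
       | E_epsA_LB \<Rightarrow> V_LB | E_LA_v \<Rightarrow> V_LA
       | E_epsB_LB \<Rightarrow> V_LB | E_LB_rho \<Rightarrow> V_LB),
     vob = (\<lambda>i. case i of
         V_LRL_AA \<Rightarrow> L\<^bsub>A\<^esub> \<cdot>\<^sub>o R\<^bsub>A\<^esub> \<cdot>\<^sub>o L\<^bsub>A\<^esub> \<cdot>\<^sub>o x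
       | V_LRL_BA \<Rightarrow> L\<^bsub>B\<^esub> \<cdot>\<^sub>o R\<^bsub>B\<^esub> \<cdot>\<^sub>o L\<^bsub>A\<^esub> \<cdot>\<^sub>o x
       | V_LRL_AB \<Rightarrow> L\<^bsub>A\<^esub> \<cdot>\<^sub>o R\<^bsub>A\<^esub> \<cdot>\<^sub>o L\<^bsub>B\<^esub> \<cdot>\<^sub>o y
       | V_LRL_BB \<Rightarrow> L\<^bsub>B\<^esub> \<cdot>\<^sub>o R\<^bsub>B\<^esub> \<cdot>\<^sub>o L\<^bsub>B\<^esub> \<cdot>\<^sub>o y
       | V_LA \<Rightarrow> L\<^bsub>A\<^esub> \<cdot>\<^sub>o x
       | V_LB \<Rightarrow> L\<^bsub>B\<^esub> \<cdot>\<^sub>o y),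
     emor = (\<lambda>e. case e of
         E_LA_rho \<Rightarrow> L\<^bsub>A\<^esub> \<cdot>\<^sub>m \<rho>
       | E_epsA_LA \<Rightarrow> \<epsilon>\<^bsub>A\<^esub> (L\<^bsub>A\<^esub> \<cdot>\<^sub>o x)
       | E_epsB_LA \<Rightarrow> \<epsilon>\<^bsub>B\<^esub> (L\<^bsub>A\<^esub> \<cdot>\<^sub>o x)
       | E_LB_w \<Rightarrow> L\<^bsub>B\<^esub> \<cdot>\<^sub>m w
       | E_epsA_LB \<Rightarrow> \<epsilon>\<^bsub>A\<^esub> (L\<^bsub>B\<^esub> \<cdot>\<^sub>o y)
       | E_LA_v \<Rightarrow> L\<^bsub>A\<^esub> \<cdot>\<^sub>m v
       | E_epsB_LB \<Rightarrow> \<epsilon>\<^bsub>B\<^esub> (L\<^bsub>B\<^esub> \<cdot>\<^sub>o y)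
       | E_LB_rho \<Rightarrow> L\<^bsub>B\<^esub> \<cdot>\<^sub>m \<sigma>)\<rparr>)"

definition has_Delta_colimits ::
  "('xo, 'xm) category \<Rightarrow> ('yo, 'ym) category \<Rightarrow> ('zo, 'zm) category
    \<Rightarrow> ('xo, 'xm, 'zo, 'zm) adj \<Rightarrow> ('yo, 'ym, 'zo, 'zm) adj \<Rightarrow> bool" where
  "has_Delta_colimits \<X> \<Y> \<Z> A B \<longleftrightarrow>
     (\<forall>p \<in> Ob (EM \<X> \<Y> A B). \<exists>D d. is_colimit \<Z> (Delta A B p) D d)"

text \<open>Colimits are unique up to isomorphism, so quantifying over all colimit cocones of \<open>\<Delta>(X)\<close> is
  the same as fixing a choice \<open>(D X, d\<^sup>A X, d\<^sup>B X)\<close> once such cocones exist. The legs \<open>d\<^sup>A\<close>, \<open>d\<^sup>B\<close>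
  are those at the vertices \<open>L\<^sub>A X\<close> and \<open>L\<^sub>B Y\<close>.\<close>

definition converts_colimits ::
  "('xo, 'xm) category \<Rightarrow> ('yo, 'ym) category \<Rightarrow> ('zo, 'zm) category
    \<Rightarrow> ('xo, 'xm, 'zo, 'zm) adj \<Rightarrow> ('yo, 'ym, 'zo, 'zm) adj \<Rightarrow> bool" where
  "converts_colimits \<X> \<Y> \<Z> A B \<longleftrightarrow>
     (\<forall>x \<rho> y \<sigma> v w D d.
        ((x, \<rho>), (y, \<sigma>), v, w) \<in> Ob (EM \<X> \<Y> A B) \<longrightarrow>
        is_colimit \<Z> (Delta A B ((x, \<rho>), (y, \<sigma>), v, w)) D d \<longrightarrow>
        is_coequaliser \<X> (R\<^bsub>A\<^esub> \<cdot>\<^sub>m L\<^bsub>A\<^esub> \<cdot>\<^sub>m \<rho>) (R\<^bsub>A\<^esub> \<cdot>\<^sub>m \<epsilon>\<^bsub>A\<^esub> (L\<^bsub>A\<^esub> \<cdot>\<^sub>o x))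
          (R\<^bsub>A\<^esub> \<cdot>\<^sub>m d V_LA) \<and>
        is_coequaliser \<Y> (R\<^bsub>B\<^esub> \<cdot>\<^sub>m L\<^bsub>B\<^esub> \<cdot>\<^sub>m \<sigma>) (R\<^bsub>B\<^esub> \<cdot>\<^sub>m \<epsilon>\<^bsub>B\<^esub> (L\<^bsub>B\<^esub> \<cdot>\<^sub>o y))
          (R\<^bsub>B\<^esub> \<cdot>\<^sub>m d V_LB))"

end

theory Submission
  imports Defs
begin

text \<open>Let \<open>K : \<Z> \<rightarrow> (\<X>, \<Y>)\<^sup>T\<close> be the comparison functor. A functor is an equivalence if and only if
  it has a left adjoint, the unit of the adjunction is invertible, and the functor reflects
  isomorphisms: the counit is then invertible because its image under the functor is, by a triangle
  identity, a left inverse of an invertible component of the unit. The left adjoint enters only through its universal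
  arrows, as \<open>equivalence_iff_universal_isos\<close>. Each of the three conditions on the double adjunction
  is one of these three properties of \<open>K\<close>.

  A cocone under \<open>\<Delta>(X)\<close> with vertex \<open>Z\<close> is given by two morphisms \<open>L\<^sub>A X \<rightarrow> Z\<close> and \<open>L\<^sub>B Y \<rightarrow> Z\<close> subject to
  four equations. Transposing along the two adjunctions gives morphisms \<open>f : X \<rightarrow> R\<^sub>A Z\<close> and
  \<open>g : Y \<rightarrow> R\<^sub>B Z\<close>, and the four equations become the conditions for \<open>(f, g)\<close> to be a morphism from the
  Eilenberg--Moore object to \<open>K Z\<close> (\<open>is_cocone_Delta_iff\<close>). So a colimit of \<open>\<Delta>(X)\<close> is a universal arrow
  to \<open>K\<close> (\<open>is_colimit_Delta_iff\<close>), and all of these colimits exist exactly when \<open>K\<close> has a left adjoint.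

  For such a colimit, \<open>R\<^sub>A d\<^sup>A = f \<odot> \<rho>\<close> because \<open>f\<close> is an algebra morphism. The action \<open>\<rho>\<close> is a split
  coequaliser of the pair that \<open>R\<^sub>A d\<^sup>A\<close> is required to coequalise, so \<open>R\<^sub>A d\<^sup>A\<close> is a coequaliser if and
  only if \<open>f\<close> is invertible, and likewise for \<open>g\<close> (\<open>coequaliser_delta_iff_iso\<close>). Isomorphisms of
  Eilenberg--Moore objects are the morphisms with invertible components (\<open>EM_iso_iff\<close>). Hence
  converting colimits into coequalisers is invertibility of the unit (\<open>converts_colimits_iff\<close>), and
  \<open>(R\<^sub>A, R\<^sub>B)\<close> reflects isomorphisms if and only if \<open>K\<close> does (\<open>reflects_isos_iff\<close>).\<close>

section \<open>Isomorphisms, commuting squares and coequalisers\<close>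

context category begin

lemma hom_Dom_in: "f \<in> hom C a b \<Longrightarrow> a \<in> Ob C"
  and hom_Cod_in: "f \<in> hom C a b \<Longrightarrow> b \<in> Ob C"
  using Dom_in Cod_in by (auto simp: hom_def)

lemma is_iso_iff:
  assumes "f \<in> hom C a b"
  shows "is_iso C f \<longleftrightarrow> (\<exists>g \<in> hom C b a. g \<odot> f = Id C a \<and> f \<odot> g = Id C b)"
  using assms by (auto simp: is_iso_def hom_def)

lemma is_isoE:
  assumes "is_iso C f" "f \<in> hom C a b"
  obtains g where "g \<in> hom C b a" "g \<odot> f = Id C a" "f \<odot> g = Id C b"
  using assms is_iso_iff by blast

lemma is_isoI:
  "\<lbrakk>f \<in> hom C a b; g \<in> hom C b a; g \<odot> f = Id C a; f \<odot> g = Id C b\<rbrakk> \<Longrightarrow> is_iso C f"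
  using is_iso_iff by blast

lemma Comp_inverse_cancel_left:
  assumes "f \<in> hom C a b" "g \<in> hom C b c" "g' \<in> hom C c b" "g' \<odot> g = Id C b"
  shows "g' \<odot> (g \<odot> f) = f"
  using Comp_assoc[OF assms(1-3)] Comp_Id_left[OF assms(1)] assms(4) by simp

lemma Comp_inverse_cancel_right:
  assumes "f \<in> hom C a b" "f' \<in> hom C b a" "g \<in> hom C b c" "f \<odot> f' = Id C b"
  shows "g \<odot> f \<odot> f' = g"
  using Comp_assoc[OF assms(2,1,3)] Comp_Id_right[OF assms(3)] assms(4) by simp

lemma is_iso_Comp:
  assumes "f \<in> hom C a b" "g \<in> hom C b c" "is_iso C f" "is_iso C g"
  shows "is_iso C (g \<odot> f)"
proof -
  obtain f' where f': "f' \<in> hom C b a" "f' \<odot> f = Id C a" "f \<odot> f' = Id C b"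
    using is_isoE[OF assms(3,1)] .
  obtain g' where g': "g' \<in> hom C c b" "g' \<odot> g = Id C b" "g \<odot> g' = Id C c"
    using is_isoE[OF assms(4,2)] .
  have "f' \<odot> g' \<odot> (g \<odot> f) = f' \<odot> (g' \<odot> (g \<odot> f))"
    using Comp_assoc[OF Comp_in[OF assms(1,2)] g'(1) f'(1)] .
  then have l: "f' \<odot> g' \<odot> (g \<odot> f) = Id C a"
    using Comp_inverse_cancel_left[OF assms(1,2) g'(1,2)] f'(2) by simp
  have "g \<odot> f \<odot> (f' \<odot> g') = g \<odot> f \<odot> f' \<odot> g'"
    using Comp_assoc[OF g'(1) f'(1) Comp_in[OF assms(1,2)]] by simp
  then have r: "g \<odot> f \<odot> (f' \<odot> g') = Id C c"
    using Comp_inverse_cancel_right[OF assms(1) f'(1) assms(2) f'(3)] g'(3) by simp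
  show ?thesis
    using is_isoI[OF Comp_in[OF assms(1,2)] Comp_in[OF g'(1) f'(1)] l r] .
qed

lemma iso_left_cancel:
  assumes "is_iso C g" "g \<in> hom C b c" "f \<in> hom C a b" "f' \<in> hom C a b" "g \<odot> f = g \<odot> f'"
  shows "f = f'"
proof -
  obtain g' where "g' \<in> hom C c b" "g' \<odot> g = Id C b" using is_isoE[OF assms(1,2)] .
  then show ?thesis
    using Comp_inverse_cancel_left[OF assms(3,2)] Comp_inverse_cancel_left[OF assms(4,2)] assms(5)
    by metis
qed

lemma iso_right_cancel:
  assumes "is_iso C f" "f \<in> hom C a b" "g \<in> hom C b c" "g' \<in> hom C b c" "g \<odot> f = g' \<odot> f"
  shows "g = g'"
proof -
  obtain f' where "f' \<in> hom C b a" "f \<odot> f' = Id C b" using is_isoE[OF assms(1,2)] .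
  then show ?thesis
    using Comp_inverse_cancel_right[OF assms(2) _ assms(3)]
      Comp_inverse_cancel_right[OF assms(2) _ assms(4)] assms(5) by metis
qed

lemma is_iso_inverse:
  assumes "f \<in> hom C a b" "g \<in> hom C b a" "g \<odot> f = Id C a" "is_iso C f"
  shows "is_iso C g"
proof -
  obtain h where h: "h \<in> hom C b a" "h \<odot> f = Id C a" "f \<odot> h = Id C b"
    using is_isoE[OF assms(4,1)] .
  have "g = h"
    using iso_right_cancel[OF assms(4,1,2) h(1)] assms(3) h(2) by simp
  then show ?thesis
    using is_isoI[OF h(1) assms(1) h(3,2)] by simp
qed

text \<open>The compatibility conditions on a morphism of Eilenberg--Moore objects are all commuting squares
  \<open>f \<odot> r = r' \<odot> u\<close> with \<open>u\<close> the image of a component under a functor. Such squares paste, and they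
  invert when \<open>f\<close> and \<open>u\<close> do, so composition and inversion of morphisms can be handled one square at
  a time.\<close>
lemma square_paste:
  assumes "u \<in> hom C a a'" "u' \<in> hom C a' a''" "r \<in> hom C a x" "r' \<in> hom C a' x'"
    "r'' \<in> hom C a'' x''" "f \<in> hom C x x'" "f' \<in> hom C x' x''"
    and sq: "f \<odot> r = r' \<odot> u" "f' \<odot> r' = r'' \<odot> u'"
  shows "f' \<odot> f \<odot> r = r'' \<odot> (u' \<odot> u)"
proof -
  have "f' \<odot> f \<odot> r = f' \<odot> (r' \<odot> u)"
    using Comp_assoc[OF assms(3,6,7)] sq(1) by simp
  also have "\<dots> = r'' \<odot> u' \<odot> u"
    using Comp_assoc[OF assms(1,4,7)] sq(2) by simp
  finally show ?thesis using Comp_assoc[OF assms(1,2,5)] by simp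
qed

lemma square_inverse:
  assumes "u \<in> hom C a a'" "u' \<in> hom C a' a" "r \<in> hom C a x" "r' \<in> hom C a' x'"
    "f \<in> hom C x x'" "f' \<in> hom C x' x"
    and inv: "f' \<odot> f = Id C x" "u \<odot> u' = Id C a'" and sq: "f \<odot> r = r' \<odot> u"
  shows "f' \<odot> r' = r \<odot> u'"
proof -
  have "f' \<odot> r' = f' \<odot> (r' \<odot> u \<odot> u')"
    using Comp_inverse_cancel_right[OF assms(1,2,4) inv(2)] by simp
  also have "\<dots> = f' \<odot> (f \<odot> (r \<odot> u'))"
    using sq Comp_assoc[OF assms(2,3,5)] by simp
  also have "\<dots> = r \<odot> u'"
    using Comp_inverse_cancel_left[OF Comp_in[OF assms(2,3)] assms(5,6) inv(1)] .
  finally show ?thesis .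
qed

text \<open>The source, the target and the vertex quantified in the definition of a coequaliser are
  determined by the given morphisms.\<close>
lemma is_coequaliser_iff:
  assumes "f \<in> hom C a b" "g \<in> hom C a b" "e \<in> hom C b c"
  shows "is_coequaliser C f g e \<longleftrightarrow> e \<odot> f = e \<odot> g \<and>
    (\<forall>c'. \<forall>e' \<in> hom C b c'. e' \<odot> f = e' \<odot> g \<longrightarrow> (\<exists>!h. h \<in> hom C c c' \<and> h \<odot> e = e'))"
proof -
  let ?univ = "\<lambda>b c. \<forall>c'. \<forall>e' \<in> hom C b c'. e' \<odot> f = e' \<odot> g
      \<longrightarrow> (\<exists>!h. h \<in> hom C c c' \<and> h \<odot> e = e')"
  have "?univ b c" if "e \<in> hom C b' c'" "?univ b' c'" for b' c'
  proof -
    have "b' = b" "c' = c" using that(1) assms(3) by (simp_all add: hom_def)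
    then show ?thesis using that(2) by (simp only:)
  qed
  then show ?thesis unfolding is_coequaliser_def using assms
    by (intro iffI; elim exE conjE; intro exI conjI) assumption+
qed

lemma coequaliser_cancel:
  assumes "is_coequaliser C f g e" and e: "e \<in> hom C b c" and h: "h \<in> hom C c c'"
    and k: "k \<in> hom C c c'" "h \<odot> e = k \<odot> e"
  shows "h = k"
proof -
  obtain a b' c'' where "f \<in> hom C a b'" "g \<in> hom C a b'" "e \<in> hom C b' c''"
    using assms(1) unfolding is_coequaliser_def by blast
  then have fg: "f \<in> hom C a b" "g \<in> hom C a b" using e by (simp_all add: hom_def)
  note co = assms(1)[unfolded is_coequaliser_iff[OF fg e]]
  have he: "h \<odot> e \<in> hom C b c'" using Comp_in e h by blast
  moreover have "h \<odot> e \<odot> f = h \<odot> e \<odot> g"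
    using co Comp_assoc[OF fg(1) e h] Comp_assoc[OF fg(2) e h] by simp
  ultimately have "\<exists>!m. m \<in> hom C c c' \<and> m \<odot> e = h \<odot> e" using co by simp
  then show ?thesis using h k by (elim ex1E) metis
qed

text \<open>Two coequalisers of the same pair differ by a unique isomorphism, so the map \<open>i\<close> between the two
  vertices has no choice: it is that isomorphism whenever \<open>i \<odot> e\<close> is a coequaliser.\<close>
lemma coequaliser_Comp_iff_iso:
  assumes "f \<in> hom C a b" "g \<in> hom C a b" and e: "e \<in> hom C b c" and i: "i \<in> hom C c d"
    and co: "is_coequaliser C f g e"
  shows "is_coequaliser C f g (i \<odot> e) \<longleftrightarrow> is_iso C i"
proof
  note fg = assms(1,2)
  have ie: "i \<odot> e \<in> hom C b d" using e i Comp_in by blast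
  note co' = co[unfolded is_coequaliser_iff[OF fg e]]
  {
    assume coi: "is_coequaliser C f g (i \<odot> e)"
    then have "\<exists>!j. j \<in> hom C d c \<and> j \<odot> (i \<odot> e) = e"
      using co' e is_coequaliser_iff[OF fg ie] by simp
    then obtain j where j: "j \<in> hom C d c" "j \<odot> (i \<odot> e) = e" by blast
    have "j \<odot> i \<odot> e = Id C c \<odot> e"
      using j Comp_assoc[OF e i j(1)] Comp_Id_left[OF e] by simp
    then have ji: "j \<odot> i = Id C c"
      using coequaliser_cancel[OF co e Comp_in[OF i j(1)]] Id_in hom_Cod_in[OF e] by blast
    have "i \<odot> j \<odot> (i \<odot> e) = Id C d \<odot> (i \<odot> e)"
      using j Comp_assoc[OF ie j(1) i] Comp_Id_left[OF ie] by simp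
    then have "i \<odot> j = Id C d"
      using coequaliser_cancel[OF coi ie Comp_in[OF j(1) i]] Id_in hom_Cod_in[OF i] by blast
    then show "is_iso C i" using is_isoI i j(1) ji by blast
  next
    assume iso: "is_iso C i"
    obtain j where j: "j \<in> hom C d c" "j \<odot> i = Id C c" "i \<odot> j = Id C d"
      using is_isoE[OF iso i] .
    have "i \<odot> e \<odot> f = i \<odot> e \<odot> g"
      using co' Comp_assoc[OF fg(1) e i] Comp_assoc[OF fg(2) e i] by simp
    moreover have "\<exists>!h. h \<in> hom C d c' \<and> h \<odot> (i \<odot> e) = e'"
      if e': "e' \<in> hom C b c'" "e' \<odot> f = e' \<odot> g" for c' e'
    proof -
      obtain h where h: "h \<in> hom C c c'" "h \<odot> e = e'" using co' e' by blast
      have "h \<odot> j \<odot> (i \<odot> e) = e'"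
        using Comp_assoc[OF ie j(1) h(1)] Comp_inverse_cancel_left[OF e i j(1,2)] h(2) by simp
      moreover have "k = k'"
        if "k \<in> hom C d c'" "k' \<in> hom C d c'" "k \<odot> (i \<odot> e) = k' \<odot> (i \<odot> e)" for k k'
      proof -
        have "k \<odot> i \<odot> e = k' \<odot> i \<odot> e" using that Comp_assoc[OF e i that(1)] Comp_assoc[OF e i that(2)] by simp
        then have "k \<odot> i = k' \<odot> i" using coequaliser_cancel[OF co e] Comp_in i that by blast
        then show ?thesis using iso_right_cancel[OF iso i] that by blast
      qed
      ultimately show ?thesis using Comp_in[OF j(1) h(1)] by (intro ex1I[of _ "h \<odot> j"]) blast+
    qed
    ultimately show "is_coequaliser C f g (i \<odot> e)" using is_coequaliser_iff[OF fg ie] by simp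
  }
qed

end

section \<open>Equivalences and universal arrows\<close>

text \<open>A left adjoint of \<open>K\<close> with its unit, described one object at a time: no functoriality in \<open>x\<close>
  has to be carried along.\<close>
definition universal_arrow ::
  "('o, 'm) category \<Rightarrow> ('p, 'n) category \<Rightarrow> ('o, 'm, 'p, 'n) cfunctor
    \<Rightarrow> 'p \<Rightarrow> 'o \<Rightarrow> 'n \<Rightarrow> bool" where
  "universal_arrow C D K x c u \<longleftrightarrow> c \<in> Ob C \<and> u \<in> hom D x (K \<cdot>\<^sub>o c) \<and>
     (\<forall>c' \<in> Ob C. \<forall>t \<in> hom D x (K \<cdot>\<^sub>o c'). \<exists>!h. h \<in> hom C c c' \<and> K \<cdot>\<^sub>m h \<odot>\<^bsub>D\<^esub> u = t)"

lemma cfunctor_id_functor: "category C \<Longrightarrow> cfunctor C C id_functor"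
  by (simp add: cfunctor_def cfunctor_axioms_def id_functor_def)

lemma cfunctor_comp_functor:
  assumes "cfunctor C D F" "cfunctor D E G"
  shows "cfunctor C E (comp_functor G F)"
proof -
  interpret F: cfunctor C D F by fact
  interpret G: cfunctor D E G by fact
  show ?thesis
  proof
    fix f g a b c
    assume f: "f \<in> hom C a b" and g: "g \<in> hom C b c"
    show "comp_functor G F \<cdot>\<^sub>m (g \<odot>\<^bsub>C\<^esub> f) =
        comp_functor G F \<cdot>\<^sub>m g \<odot>\<^bsub>E\<^esub> comp_functor G F \<cdot>\<^sub>m f"
      using F.fmor_Comp[OF f g] G.fmor_Comp[OF F.fmor_in[OF f] F.fmor_in[OF g]]
      by (simp add: comp_functor_def)
  qed (auto simp: comp_functor_def F.fob_in G.fob_in F.fmor_in G.fmor_in F.fmor_Id G.fmor_Id)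
qed

lemma universal_arrow_factor:
  assumes "universal_arrow C D K x c u" "c' \<in> Ob C" "t \<in> hom D x (K \<cdot>\<^sub>o c')"
  obtains h where "h \<in> hom C c c'" "K \<cdot>\<^sub>m h \<odot>\<^bsub>D\<^esub> u = t"
proof -
  have "\<exists>!h. h \<in> hom C c c' \<and> K \<cdot>\<^sub>m h \<odot>\<^bsub>D\<^esub> u = t"
    using assms unfolding universal_arrow_def by simp
  then show ?thesis using that by (elim ex1E) blast
qed

context cfunctor begin

lemma fmor_iso:
  assumes "is_iso C f" "f \<in> hom C a b"
  shows "is_iso D (F \<cdot>\<^sub>m f)"
proof -
  obtain g where g: "g \<in> hom C b a" "g \<odot>\<^bsub>C\<^esub> f = Id C a" "f \<odot>\<^bsub>C\<^esub> g = Id C b"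
    using dom.is_isoE[OF assms] .
  have ob: "a \<in> Ob C" "b \<in> Ob C"
    using dom.hom_Dom_in dom.hom_Cod_in assms by auto
  show ?thesis
    using cod.is_isoI[OF fmor_in[OF assms(2)] fmor_in[OF g(1)]]
      fmor_Comp[OF assms(2) g(1)] fmor_Comp[OF g(1) assms(2)] fmor_Id ob g by simp
qed

lemma universal_arrow_cancel:
  assumes "universal_arrow C D F x c u" "h \<in> hom C c c'" "k \<in> hom C c c'"
    "F \<cdot>\<^sub>m h \<odot>\<^bsub>D\<^esub> u = F \<cdot>\<^sub>m k \<odot>\<^bsub>D\<^esub> u"
  shows "h = k"
proof -
  have "u \<in> hom D x (F \<cdot>\<^sub>o c)" "c' \<in> Ob C"
    using assms(1,2) dom.hom_Cod_in unfolding universal_arrow_def by auto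
  then have "F \<cdot>\<^sub>m h \<odot>\<^bsub>D\<^esub> u \<in> hom D x (F \<cdot>\<^sub>o c')" using cod.Comp_in fmor_in assms(2) by blast
  then have "\<exists>!m. m \<in> hom C c c' \<and> F \<cdot>\<^sub>m m \<odot>\<^bsub>D\<^esub> u = F \<cdot>\<^sub>m h \<odot>\<^bsub>D\<^esub> u"
    using assms(1) \<open>c' \<in> Ob C\<close> unfolding universal_arrow_def by simp
  then show ?thesis using assms(2-4) by (elim ex1E) metis
qed

text \<open>Choosing a universal arrow \<open>u\<^sub>x : x \<rightarrow> F (g x)\<close> at each \<open>x\<close> yields a left adjoint \<open>G\<close> of \<open>F\<close> with
  unit \<open>u\<close>. One natural isomorphism \<open>\<beta>\<close> is the inverse of the unit. The other is the counit \<open>\<alpha>\<close>: by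
  the triangle identity \<open>F \<alpha>\<^sub>c\<close> is a left inverse of the isomorphism \<open>u\<close>, hence an isomorphism, and
  \<open>F\<close> reflects isomorphisms.\<close>
lemma is_equivalence_of_universal_isos:
  assumes ex: "\<And>x. x \<in> Ob D \<Longrightarrow> \<exists>c u. universal_arrow C D F x c u"
    and iso: "\<And>x c u. \<lbrakk>x \<in> Ob D; universal_arrow C D F x c u\<rbrakk> \<Longrightarrow> is_iso D u"
    and refl: "\<And>f. \<lbrakk>f \<in> Mor C; is_iso D (F \<cdot>\<^sub>m f)\<rbrakk> \<Longrightarrow> is_iso C f"
  shows "is_equivalence C D F"
proof -
  obtain g u where gu: "\<And>x. x \<in> Ob D \<Longrightarrow> universal_arrow C D F x (g x) (u x)"
    using ex by metis
  have g: "g x \<in> Ob C" and u: "u x \<in> hom D x (F \<cdot>\<^sub>o g x)" if "x \<in> Ob D" for x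
    using gu[OF that] unfolding universal_arrow_def by auto
  have cancel: "h = k"
    if "x \<in> Ob D" "h \<in> hom C (g x) c'" "k \<in> hom C (g x) c'"
      "F \<cdot>\<^sub>m h \<odot>\<^bsub>D\<^esub> u x = F \<cdot>\<^sub>m k \<odot>\<^bsub>D\<^esub> u x" for x h k c'
    using universal_arrow_cancel[OF gu] that by blast
  (* The action on morphisms is forced: u must become natural. *)
  define gm where "gm f = (SOME h. h \<in> hom C (g (Dom D f)) (g (Cod D f)) \<and>
      F \<cdot>\<^sub>m h \<odot>\<^bsub>D\<^esub> u (Dom D f) = u (Cod D f) \<odot>\<^bsub>D\<^esub> f)" for f
  have gm: "gm f \<in> hom C (g x) (g y)" "F \<cdot>\<^sub>m gm f \<odot>\<^bsub>D\<^esub> u x = u y \<odot>\<^bsub>D\<^esub> f"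
    if "f \<in> hom D x y" for f x y
  proof -
    have xy: "x \<in> Ob D" "y \<in> Ob D" "Dom D f = x" "Cod D f = y"
      using that cod.hom_Dom_in cod.hom_Cod_in by (auto simp: hom_def)
    have "u y \<odot>\<^bsub>D\<^esub> f \<in> hom D x (F \<cdot>\<^sub>o g y)" using cod.Comp_in that u xy by blast
    then have "\<exists>h. h \<in> hom C (g x) (g y) \<and> F \<cdot>\<^sub>m h \<odot>\<^bsub>D\<^esub> u x = u y \<odot>\<^bsub>D\<^esub> f"
      using universal_arrow_factor[OF gu[OF xy(1)] g[OF xy(2)]] by blast
    then have "gm f \<in> hom C (g x) (g y) \<and> F \<cdot>\<^sub>m gm f \<odot>\<^bsub>D\<^esub> u x = u y \<odot>\<^bsub>D\<^esub> f"
      unfolding gm_def xy by (rule someI_ex)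
    then show "gm f \<in> hom C (g x) (g y)" "F \<cdot>\<^sub>m gm f \<odot>\<^bsub>D\<^esub> u x = u y \<odot>\<^bsub>D\<^esub> f" by auto
  qed
  define G where "G = \<lparr>fob = g, fmor = gm\<rparr>"
  have [simp]: "G \<cdot>\<^sub>o x = g x" "G \<cdot>\<^sub>m f = gm f" for x f by (auto simp: G_def)
  interpret G: cfunctor D C G
  proof
    fix x assume x: "x \<in> Ob D"
    show "G \<cdot>\<^sub>o x \<in> Ob C" using g x by simp
    have "F \<cdot>\<^sub>m gm (Id D x) \<odot>\<^bsub>D\<^esub> u x = F \<cdot>\<^sub>m Id C (g x) \<odot>\<^bsub>D\<^esub> u x"
      using gm(2)[OF cod.Id_in[OF x]] fmor_Id[OF g[OF x]] cod.Comp_Id_left[OF u[OF x]]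
        cod.Comp_Id_right[OF u[OF x]] by simp
    then show "G \<cdot>\<^sub>m Id D x = Id C (G \<cdot>\<^sub>o x)"
      using cancel[OF x gm(1)[OF cod.Id_in[OF x]] dom.Id_in[OF g[OF x]]] by simp
  next
    fix f x y assume f: "f \<in> hom D x y"
    show "G \<cdot>\<^sub>m f \<in> hom C (G \<cdot>\<^sub>o x) (G \<cdot>\<^sub>o y)" using gm f by simp
    fix h z assume h: "h \<in> hom D y z"
    note ob = cod.hom_Dom_in[OF f] cod.hom_Dom_in[OF h] cod.hom_Cod_in[OF h]
    have "F \<cdot>\<^sub>m (gm h \<odot>\<^bsub>C\<^esub> gm f) \<odot>\<^bsub>D\<^esub> u x = F \<cdot>\<^sub>m gm h \<odot>\<^bsub>D\<^esub> (F \<cdot>\<^sub>m gm f \<odot>\<^bsub>D\<^esub> u x)"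
      using fmor_Comp[OF gm(1)[OF f] gm(1)[OF h]]
        cod.Comp_assoc[OF u[OF ob(1)] fmor_in[OF gm(1)[OF f]] fmor_in[OF gm(1)[OF h]]] by simp
    also have "\<dots> = F \<cdot>\<^sub>m gm h \<odot>\<^bsub>D\<^esub> u y \<odot>\<^bsub>D\<^esub> f"
      using gm(2)[OF f] cod.Comp_assoc[OF f u[OF ob(2)] fmor_in[OF gm(1)[OF h]]] by simp
    also have "\<dots> = u z \<odot>\<^bsub>D\<^esub> (h \<odot>\<^bsub>D\<^esub> f)"
      using gm(2)[OF h] cod.Comp_assoc[OF f h u[OF ob(3)]] by simp
    also have "\<dots> = F \<cdot>\<^sub>m gm (h \<odot>\<^bsub>D\<^esub> f) \<odot>\<^bsub>D\<^esub> u x"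
      using gm(2)[OF cod.Comp_in[OF f h]] by simp
    finally show "G \<cdot>\<^sub>m (h \<odot>\<^bsub>D\<^esub> f) = G \<cdot>\<^sub>m h \<odot>\<^bsub>C\<^esub> G \<cdot>\<^sub>m f"
      using cancel[OF ob(1) gm(1)[OF cod.Comp_in[OF f h]]
          dom.Comp_in[OF gm(1)[OF f] gm(1)[OF h]]] by simp
  qed
  have "\<exists>b \<in> hom D (F \<cdot>\<^sub>o g x) x. b \<odot>\<^bsub>D\<^esub> u x = Id D x \<and> u x \<odot>\<^bsub>D\<^esub> b = Id D (F \<cdot>\<^sub>o g x)"
    if "x \<in> Ob D" for x
    using iso[OF that gu[OF that]] cod.is_iso_iff[OF u[OF that]] by simp
  then obtain \<beta> where \<beta>: "\<beta> x \<in> hom D (F \<cdot>\<^sub>o g x) x" "\<beta> x \<odot>\<^bsub>D\<^esub> u x = Id D x"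
      "u x \<odot>\<^bsub>D\<^esub> \<beta> x = Id D (F \<cdot>\<^sub>o g x)" if "x \<in> Ob D" for x
    by metis
  have "\<exists>a \<in> hom C (g (F \<cdot>\<^sub>o c)) c. F \<cdot>\<^sub>m a \<odot>\<^bsub>D\<^esub> u (F \<cdot>\<^sub>o c) = Id D (F \<cdot>\<^sub>o c)"
    if "c \<in> Ob C" for c
    using universal_arrow_factor[OF gu that cod.Id_in] fob_in[OF that] by blast
  then obtain \<alpha> where \<alpha>: "\<alpha> c \<in> hom C (g (F \<cdot>\<^sub>o c)) c"
      "F \<cdot>\<^sub>m \<alpha> c \<odot>\<^bsub>D\<^esub> u (F \<cdot>\<^sub>o c) = Id D (F \<cdot>\<^sub>o c)" if "c \<in> Ob C" for c
    by metis
  have "naturally_isomorphic D D (comp_functor F G) id_functor"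
    unfolding naturally_isomorphic_def
  proof (intro exI conjI ballI)
    show "nat_trans D D (comp_functor F G) id_functor \<beta>"
    proof (intro nat_trans.intro nat_trans_axioms.intro)
      fix f x y assume f: "f \<in> hom D x y"
      note ob = cod.hom_Dom_in[OF f] cod.hom_Cod_in[OF f]
      note Ff = fmor_in[OF gm(1)[OF f]]
      have "\<beta> y \<odot>\<^bsub>D\<^esub> F \<cdot>\<^sub>m gm f \<odot>\<^bsub>D\<^esub> u x = \<beta> y \<odot>\<^bsub>D\<^esub> (u y \<odot>\<^bsub>D\<^esub> f)"
        using gm(2)[OF f] cod.Comp_assoc[OF u[OF ob(1)] Ff \<beta>(1)[OF ob(2)]] by simp
      also have "\<dots> = f"
        using cod.Comp_inverse_cancel_left[OF f u[OF ob(2)] \<beta>(1,2)[OF ob(2)]] .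
      also have "\<dots> = f \<odot>\<^bsub>D\<^esub> \<beta> x \<odot>\<^bsub>D\<^esub> u x"
        using cod.Comp_inverse_cancel_right[OF \<beta>(1)[OF ob(1)] u[OF ob(1)] f \<beta>(2)[OF ob(1)]] by simp
      finally have "\<beta> y \<odot>\<^bsub>D\<^esub> F \<cdot>\<^sub>m gm f = f \<odot>\<^bsub>D\<^esub> \<beta> x"
        using cod.iso_right_cancel[OF iso[OF ob(1) gu[OF ob(1)]] u[OF ob(1)]]
          cod.Comp_in[OF Ff \<beta>(1)[OF ob(2)]] cod.Comp_in[OF \<beta>(1)[OF ob(1)] f] by blast
      then show "\<beta> y \<odot>\<^bsub>D\<^esub> comp_functor F G \<cdot>\<^sub>m f = id_functor \<cdot>\<^sub>m f \<odot>\<^bsub>D\<^esub> \<beta> x"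
        by (simp add: comp_functor_def id_functor_def)
    qed (use \<beta> cfunctor_id_functor[OF cod.category_axioms]
        cfunctor_comp_functor[OF G.cfunctor_axioms cfunctor_axioms] in
        \<open>auto simp: comp_functor_def id_functor_def\<close>)
    show "is_iso D (\<beta> x)" if "x \<in> Ob D" for x
      using cod.is_isoI[OF \<beta>(1)[OF that] u[OF that]] \<beta>(2,3)[OF that] by blast
  qed
  moreover have "naturally_isomorphic C C (comp_functor G F) id_functor"
    unfolding naturally_isomorphic_def
  proof (intro exI conjI ballI)
    show "nat_trans C C (comp_functor G F) id_functor \<alpha>"
    proof (intro nat_trans.intro nat_trans_axioms.intro)
      fix f a b assume f: "f \<in> hom C a b"
      note ob = dom.hom_Dom_in[OF f] dom.hom_Cod_in[OF f]
      note Ff = fmor_in[OF f]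
      note ua = u[OF fob_in[OF ob(1)]] and ub = u[OF fob_in[OF ob(2)]]
      note Ga = gm(1)[OF Ff]
      note F\<alpha>a = fmor_in[OF \<alpha>(1)[OF ob(1)]] and F\<alpha>b = fmor_in[OF \<alpha>(1)[OF ob(2)]]
      have "F \<cdot>\<^sub>m (\<alpha> b \<odot>\<^bsub>C\<^esub> gm (F \<cdot>\<^sub>m f)) \<odot>\<^bsub>D\<^esub> u (F \<cdot>\<^sub>o a)
          = F \<cdot>\<^sub>m \<alpha> b \<odot>\<^bsub>D\<^esub> (u (F \<cdot>\<^sub>o b) \<odot>\<^bsub>D\<^esub> F \<cdot>\<^sub>m f)"
        using fmor_Comp[OF Ga \<alpha>(1)[OF ob(2)]] cod.Comp_assoc[OF ua fmor_in[OF Ga] F\<alpha>b]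
          gm(2)[OF Ff] by simp
      also have "\<dots> = F \<cdot>\<^sub>m f"
        using cod.Comp_inverse_cancel_left[OF Ff ub F\<alpha>b \<alpha>(2)[OF ob(2)]] .
      also have "\<dots> = F \<cdot>\<^sub>m (f \<odot>\<^bsub>C\<^esub> \<alpha> a) \<odot>\<^bsub>D\<^esub> u (F \<cdot>\<^sub>o a)"
        using cod.Comp_inverse_cancel_right[OF F\<alpha>a ua Ff \<alpha>(2)[OF ob(1)]]
          fmor_Comp[OF \<alpha>(1)[OF ob(1)] f] by simp
      finally have "\<alpha> b \<odot>\<^bsub>C\<^esub> gm (F \<cdot>\<^sub>m f) = f \<odot>\<^bsub>C\<^esub> \<alpha> a"
        using cancel[OF fob_in[OF ob(1)]] dom.Comp_in[OF Ga \<alpha>(1)[OF ob(2)]]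
          dom.Comp_in[OF \<alpha>(1)[OF ob(1)] f] by blast
      then show "\<alpha> b \<odot>\<^bsub>C\<^esub> comp_functor G F \<cdot>\<^sub>m f = id_functor \<cdot>\<^sub>m f \<odot>\<^bsub>C\<^esub> \<alpha> a"
        by (simp add: comp_functor_def id_functor_def)
    qed (use \<alpha> cfunctor_id_functor[OF dom.category_axioms]
        cfunctor_comp_functor[OF cfunctor_axioms G.cfunctor_axioms] in
        \<open>auto simp: comp_functor_def id_functor_def\<close>)
    show "is_iso C (\<alpha> c)" if c: "c \<in> Ob C" for c
    proof -
      have "is_iso D (F \<cdot>\<^sub>m \<alpha> c)"
        using cod.is_iso_inverse[OF u[OF fob_in[OF c]] fmor_in[OF \<alpha>(1)[OF c]] \<alpha>(2)[OF c]
            iso[OF fob_in[OF c] gu[OF fob_in[OF c]]]] .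
      then show ?thesis using refl \<alpha>(1)[OF c] by (auto simp: hom_def)
    qed
  qed
  ultimately show ?thesis
    unfolding is_equivalence_def using cfunctor_axioms G.cfunctor_axioms by blast
qed

lemma equivalence_faithful:
  assumes "naturally_isomorphic C C (comp_functor G F) id_functor"
    and f: "f \<in> hom C a b" "f' \<in> hom C a b" "F \<cdot>\<^sub>m f = F \<cdot>\<^sub>m f'"
  shows "f = f'"
proof -
  obtain \<alpha> where "nat_trans C C (comp_functor G F) id_functor \<alpha>"
    and iso: "\<And>c. c \<in> Ob C \<Longrightarrow> is_iso C (\<alpha> c)"
    using assms(1) unfolding naturally_isomorphic_def by blast
  then interpret \<alpha>: nat_trans C C "comp_functor G F" id_functor \<alpha> by blast
  note a = dom.hom_Dom_in[OF f(1)]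
  have "f \<odot>\<^bsub>C\<^esub> \<alpha> a = f' \<odot>\<^bsub>C\<^esub> \<alpha> a"
    using \<alpha>.naturality[OF f(1)] \<alpha>.naturality[OF f(2)] f(3)
    by (simp add: comp_functor_def id_functor_def)
  then show ?thesis
    using dom.iso_right_cancel[OF iso[OF a] _ f(1,2)] \<alpha>.component_in[OF a]
    by (simp add: comp_functor_def id_functor_def)
qed

text \<open>A morphism \<open>h : F a \<rightarrow> F b\<close> is lifted by conjugating \<open>G h\<close> with the natural isomorphism
  \<open>\<alpha> : G F \<rightarrow> 1\<close>. The image of the lift agrees with \<open>h\<close> after applying \<open>G\<close>, and \<open>G\<close> is faithful because
  it is an equivalence as well.\<close>
lemma equivalence_full:
  assumes "cfunctor D C G" "naturally_isomorphic C C (comp_functor G F) id_functor"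
    "naturally_isomorphic D D (comp_functor F G) id_functor"
    and h: "h \<in> hom D (F \<cdot>\<^sub>o a) (F \<cdot>\<^sub>o b)" and ob: "a \<in> Ob C" "b \<in> Ob C"
  obtains f where "f \<in> hom C a b" "F \<cdot>\<^sub>m f = h"
proof -
  interpret G: cfunctor D C G by fact
  obtain \<alpha> where "nat_trans C C (comp_functor G F) id_functor \<alpha>"
    and iso: "\<And>c. c \<in> Ob C \<Longrightarrow> is_iso C (\<alpha> c)"
    using assms(2) unfolding naturally_isomorphic_def by blast
  then interpret \<alpha>: nat_trans C C "comp_functor G F" id_functor \<alpha> by blast
  have \<alpha>: "\<alpha> c \<in> hom C (G \<cdot>\<^sub>o F \<cdot>\<^sub>o c) c" if "c \<in> Ob C" for c
    using \<alpha>.component_in[OF that] by (simp add: comp_functor_def id_functor_def)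
  obtain \<alpha>' where \<alpha>': "\<alpha>' \<in> hom C a (G \<cdot>\<^sub>o F \<cdot>\<^sub>o a)" "\<alpha>' \<odot>\<^bsub>C\<^esub> \<alpha> a = Id C (G \<cdot>\<^sub>o F \<cdot>\<^sub>o a)"
    using dom.is_isoE[OF iso[OF ob(1)] \<alpha>[OF ob(1)]] .
  note Gh = G.fmor_in[OF h]
  note \<alpha>h = dom.Comp_in[OF Gh \<alpha>[OF ob(2)]]
  define f where "f = \<alpha> b \<odot>\<^bsub>C\<^esub> G \<cdot>\<^sub>m h \<odot>\<^bsub>C\<^esub> \<alpha>'"
  have f: "f \<in> hom C a b" unfolding f_def using dom.Comp_in[OF \<alpha>'(1) \<alpha>h] .
  have "\<alpha> b \<odot>\<^bsub>C\<^esub> G \<cdot>\<^sub>m F \<cdot>\<^sub>m f = f \<odot>\<^bsub>C\<^esub> \<alpha> a"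
    using \<alpha>.naturality[OF f] by (simp add: comp_functor_def id_functor_def)
  also have "\<dots> = \<alpha> b \<odot>\<^bsub>C\<^esub> G \<cdot>\<^sub>m h"
    unfolding f_def using dom.Comp_inverse_cancel_right[OF \<alpha>'(1) \<alpha>[OF ob(1)] \<alpha>h \<alpha>'(2)] .
  finally have "G \<cdot>\<^sub>m F \<cdot>\<^sub>m f = G \<cdot>\<^sub>m h"
    using dom.iso_left_cancel[OF iso[OF ob(2)] \<alpha>[OF ob(2)] G.fmor_in[OF fmor_in[OF f]] Gh] by blast
  then have "F \<cdot>\<^sub>m f = h"
    using G.equivalence_faithful[OF assms(3) fmor_in[OF f] h] by blast
  then show thesis using that f by blast
qed

text \<open>The bridge between equivalences and the three conditions on a double adjunction. For an
  equivalence, \<open>F\<close> is full and faithful, so it reflects isomorphisms and the inverse of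
  \<open>\<beta>\<^sub>x : F (G x) \<rightarrow> x\<close> is a universal arrow; any other universal arrow differs from it by the image of
  an isomorphism. For the converse, universal isomorphisms assemble into an inverse of \<open>F\<close>.\<close>
lemma equivalence_iff_universal_isos:
  "is_equivalence C D F \<longleftrightarrow>
     (\<forall>x \<in> Ob D. \<exists>c u. universal_arrow C D F x c u) \<and>
     (\<forall>f \<in> Mor C. is_iso D (F \<cdot>\<^sub>m f) \<longrightarrow> is_iso C f) \<and>
     (\<forall>x \<in> Ob D. \<forall>c u. universal_arrow C D F x c u \<longrightarrow> is_iso D u)"
proof
  assume "is_equivalence C D F"
  then obtain G where G: "cfunctor D C G"
      "naturally_isomorphic C C (comp_functor G F) id_functor"
      "naturally_isomorphic D D (comp_functor F G) id_functor"
    unfolding is_equivalence_def by blast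
  interpret G: cfunctor D C G by fact
  note faithful = equivalence_faithful[OF G(2)] and full = equivalence_full[OF G]
  obtain \<beta> where "nat_trans D D (comp_functor F G) id_functor \<beta>"
    and iso: "\<And>x. x \<in> Ob D \<Longrightarrow> is_iso D (\<beta> x)"
    using G(3) unfolding naturally_isomorphic_def by blast
  then interpret \<beta>: nat_trans D D "comp_functor F G" id_functor \<beta> by blast
  have \<beta>: "\<beta> x \<in> hom D (F \<cdot>\<^sub>o G \<cdot>\<^sub>o x) x" if "x \<in> Ob D" for x
    using \<beta>.component_in[OF that] by (simp add: comp_functor_def id_functor_def)
  have uni: "\<exists>u. universal_arrow C D F x (G \<cdot>\<^sub>o x) u \<and> is_iso D u" if x: "x \<in> Ob D" for x
  proof -
    note Gx = G.fob_in[OF x]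
    obtain u where u: "u \<in> hom D x (F \<cdot>\<^sub>o G \<cdot>\<^sub>o x)" "u \<odot>\<^bsub>D\<^esub> \<beta> x = Id D (F \<cdot>\<^sub>o G \<cdot>\<^sub>o x)"
        "\<beta> x \<odot>\<^bsub>D\<^esub> u = Id D x"
      using cod.is_isoE[OF iso[OF x] \<beta>[OF x]] .
    have isou: "is_iso D u" using cod.is_isoI[OF u(1) \<beta>[OF x] u(3,2)] .
    have "\<exists>!h. h \<in> hom C (G \<cdot>\<^sub>o x) c' \<and> F \<cdot>\<^sub>m h \<odot>\<^bsub>D\<^esub> u = t"
      if c': "c' \<in> Ob C" and t: "t \<in> hom D x (F \<cdot>\<^sub>o c')" for c' t
    proof -
      obtain h where h: "h \<in> hom C (G \<cdot>\<^sub>o x) c'" "F \<cdot>\<^sub>m h = t \<odot>\<^bsub>D\<^esub> \<beta> x"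
        using full[OF cod.Comp_in[OF \<beta>[OF x] t] Gx c'] by blast
      have "F \<cdot>\<^sub>m h \<odot>\<^bsub>D\<^esub> u = t"
        using h(2) cod.Comp_inverse_cancel_right[OF \<beta>[OF x] u(1) t u(3)] by simp
      moreover have "k = k'" if k: "k \<in> hom C (G \<cdot>\<^sub>o x) c'" "k' \<in> hom C (G \<cdot>\<^sub>o x) c'"
        "F \<cdot>\<^sub>m k \<odot>\<^bsub>D\<^esub> u = F \<cdot>\<^sub>m k' \<odot>\<^bsub>D\<^esub> u" for k k'
        using faithful[OF k(1,2)] cod.iso_right_cancel[OF isou u(1)] fmor_in k by blast
      ultimately show ?thesis using h(1) by (intro ex1I[of _ h]) blast+
    qed
    then show ?thesis using isou u(1) Gx unfolding universal_arrow_def by blast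
  qed
  have refl: "is_iso C f" if fC: "f \<in> Mor C" and Ff: "is_iso D (F \<cdot>\<^sub>m f)" for f
  proof -
    obtain a b where f: "f \<in> hom C a b" using fC unfolding hom_def by blast
    note ob = dom.hom_Dom_in[OF f] dom.hom_Cod_in[OF f]
    obtain h where h: "h \<in> hom D (F \<cdot>\<^sub>o b) (F \<cdot>\<^sub>o a)"
      "h \<odot>\<^bsub>D\<^esub> F \<cdot>\<^sub>m f = Id D (F \<cdot>\<^sub>o a)" "F \<cdot>\<^sub>m f \<odot>\<^bsub>D\<^esub> h = Id D (F \<cdot>\<^sub>o b)"
      using cod.is_isoE[OF Ff fmor_in[OF f]] .
    obtain k where k: "k \<in> hom C b a" "F \<cdot>\<^sub>m k = h" using full[OF h(1) ob(2,1)] by blast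
    have "k \<odot>\<^bsub>C\<^esub> f = Id C a"
      using faithful[OF dom.Comp_in[OF f k(1)] dom.Id_in[OF ob(1)]]
        fmor_Comp[OF f k(1)] fmor_Id[OF ob(1)] h k by simp
    moreover have "f \<odot>\<^bsub>C\<^esub> k = Id C b"
      using faithful[OF dom.Comp_in[OF k(1) f] dom.Id_in[OF ob(2)]]
        fmor_Comp[OF k(1) f] fmor_Id[OF ob(2)] h k by simp
    ultimately show ?thesis using dom.is_isoI[OF f k(1)] by blast
  qed
  have "is_iso D t" if x: "x \<in> Ob D" and t: "universal_arrow C D F x c t" for x c t
  proof -
    obtain u where u: "universal_arrow C D F x (G \<cdot>\<^sub>o x) u" "is_iso D u" using uni[OF x] by blast
    have u': "G \<cdot>\<^sub>o x \<in> Ob C" "u \<in> hom D x (F \<cdot>\<^sub>o G \<cdot>\<^sub>o x)" and t': "c \<in> Ob C" "t \<in> hom D x (F \<cdot>\<^sub>o c)"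
      using u(1) t unfolding universal_arrow_def by simp_all
    obtain h where h: "h \<in> hom C (G \<cdot>\<^sub>o x) c" "F \<cdot>\<^sub>m h \<odot>\<^bsub>D\<^esub> u = t"
      using universal_arrow_factor[OF u(1) t'] .
    obtain k where k: "k \<in> hom C c (G \<cdot>\<^sub>o x)" "F \<cdot>\<^sub>m k \<odot>\<^bsub>D\<^esub> t = u"
      using universal_arrow_factor[OF t u'] .
    have "F \<cdot>\<^sub>m (k \<odot>\<^bsub>C\<^esub> h) \<odot>\<^bsub>D\<^esub> u = F \<cdot>\<^sub>m Id C (G \<cdot>\<^sub>o x) \<odot>\<^bsub>D\<^esub> u"
      using fmor_Comp[OF h(1) k(1)] cod.Comp_assoc[OF _ fmor_in[OF h(1)] fmor_in[OF k(1)], of u x]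
        h(2) k(2) u' fmor_Id cod.Comp_Id_left by simp
    then have kh: "k \<odot>\<^bsub>C\<^esub> h = Id C (G \<cdot>\<^sub>o x)"
      using universal_arrow_cancel[OF u(1) dom.Comp_in[OF h(1) k(1)]] dom.Id_in u' by blast
    have "F \<cdot>\<^sub>m (h \<odot>\<^bsub>C\<^esub> k) \<odot>\<^bsub>D\<^esub> t = F \<cdot>\<^sub>m Id C c \<odot>\<^bsub>D\<^esub> t"
      using fmor_Comp[OF k(1) h(1)] cod.Comp_assoc[OF _ fmor_in[OF k(1)] fmor_in[OF h(1)], of t x]
        h(2) k(2) t' fmor_Id cod.Comp_Id_left by simp
    then have hk: "h \<odot>\<^bsub>C\<^esub> k = Id C c"
      using universal_arrow_cancel[OF t dom.Comp_in[OF k(1) h(1)]] dom.Id_in t' by blast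
    have "is_iso C h" using dom.is_isoI[OF h(1) k(1) kh hk] .
    then show ?thesis
      using cod.is_iso_Comp[OF _ fmor_in[OF h(1)] u(2)] fmor_iso h u' by blast
  qed
  then show "(\<forall>x \<in> Ob D. \<exists>c u. universal_arrow C D F x c u) \<and>
     (\<forall>f \<in> Mor C. is_iso D (F \<cdot>\<^sub>m f) \<longrightarrow> is_iso C f) \<and>
     (\<forall>x \<in> Ob D. \<forall>c u. universal_arrow C D F x c u \<longrightarrow> is_iso D u)"
    using uni refl by blast
next
  assume "(\<forall>x \<in> Ob D. \<exists>c u. universal_arrow C D F x c u) \<and>
     (\<forall>f \<in> Mor C. is_iso D (F \<cdot>\<^sub>m f) \<longrightarrow> is_iso C f) \<and>
     (\<forall>x \<in> Ob D. \<forall>c u. universal_arrow C D F x c u \<longrightarrow> is_iso D u)"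
  then show "is_equivalence C D F"
    by (intro is_equivalence_of_universal_isos) blast+
qed

end

section \<open>Transposition along one adjunction\<close>

context adjunction begin

text \<open>The transpose \<open>L x \<rightarrow> z\<close> of a morphism \<open>f : x \<rightarrow> R z\<close>; the inverse passage sends \<open>d\<close> to
  \<open>R d \<odot> \<eta>\<^sub>x\<close>.\<close>
abbreviation flat :: "'zo \<Rightarrow> 'xm \<Rightarrow> 'zm" where
  "flat z f \<equiv> \<epsilon>\<^bsub>A\<^esub> z \<odot>\<^bsub>\<Z>\<^esub> L\<^bsub>A\<^esub> \<cdot>\<^sub>m f"

lemma unit_in: "x \<in> Ob \<X> \<Longrightarrow> \<eta>\<^bsub>A\<^esub> x \<in> hom \<X> x (R\<^bsub>A\<^esub> \<cdot>\<^sub>o L\<^bsub>A\<^esub> \<cdot>\<^sub>o x)"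
  using unit.component_in[of x] by (simp add: comp_functor_def id_functor_def)

lemma unit_natural:
  "f \<in> hom \<X> x y \<Longrightarrow> \<eta>\<^bsub>A\<^esub> y \<odot>\<^bsub>\<X>\<^esub> f = R\<^bsub>A\<^esub> \<cdot>\<^sub>m L\<^bsub>A\<^esub> \<cdot>\<^sub>m f \<odot>\<^bsub>\<X>\<^esub> \<eta>\<^bsub>A\<^esub> x"
  using unit.naturality[of f x y] by (simp add: comp_functor_def id_functor_def)

lemma counit_in: "z \<in> Ob \<Z> \<Longrightarrow> \<epsilon>\<^bsub>A\<^esub> z \<in> hom \<Z> (L\<^bsub>A\<^esub> \<cdot>\<^sub>o R\<^bsub>A\<^esub> \<cdot>\<^sub>o z) z"
  using counit.component_in[of z] by (simp add: comp_functor_def id_functor_def)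

lemma counit_natural:
  "h \<in> hom \<Z> z z' \<Longrightarrow> \<epsilon>\<^bsub>A\<^esub> z' \<odot>\<^bsub>\<Z>\<^esub> L\<^bsub>A\<^esub> \<cdot>\<^sub>m R\<^bsub>A\<^esub> \<cdot>\<^sub>m h = h \<odot>\<^bsub>\<Z>\<^esub> \<epsilon>\<^bsub>A\<^esub> z"
  using counit.naturality[of h z z'] by (simp add: comp_functor_def id_functor_def)

lemma flat_in:
  assumes "f \<in> hom \<X> x (R\<^bsub>A\<^esub> \<cdot>\<^sub>o z)" "z \<in> Ob \<Z>"
  shows "flat z f \<in> hom \<Z> (L\<^bsub>A\<^esub> \<cdot>\<^sub>o x) z"
  using left.cod.Comp_in[OF left.fmor_in[OF assms(1)] counit_in[OF assms(2)]] .

lemma sharp_flat: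
  assumes f: "f \<in> hom \<X> x (R\<^bsub>A\<^esub> \<cdot>\<^sub>o z)" and z: "z \<in> Ob \<Z>"
  shows "R\<^bsub>A\<^esub> \<cdot>\<^sub>m flat z f \<odot>\<^bsub>\<X>\<^esub> \<eta>\<^bsub>A\<^esub> x = f"
proof -
  note x = left.dom.hom_Dom_in[OF f] and Rz = right.fob_in[OF z]
  note Lf = left.fmor_in[OF f] and e = counit_in[OF z]
  have "R\<^bsub>A\<^esub> \<cdot>\<^sub>m flat z f \<odot>\<^bsub>\<X>\<^esub> \<eta>\<^bsub>A\<^esub> x
      = R\<^bsub>A\<^esub> \<cdot>\<^sub>m \<epsilon>\<^bsub>A\<^esub> z \<odot>\<^bsub>\<X>\<^esub> (\<eta>\<^bsub>A\<^esub> (R\<^bsub>A\<^esub> \<cdot>\<^sub>o z) \<odot>\<^bsub>\<X>\<^esub> f)"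
    using right.fmor_Comp[OF Lf e] unit_natural[OF f]
      left.dom.Comp_assoc[OF unit_in[OF x] right.fmor_in[OF Lf] right.fmor_in[OF e]] by simp
  then show ?thesis
    using left.dom.Comp_inverse_cancel_left[OF f unit_in[OF Rz] right.fmor_in[OF e]
        triangle_right[OF z]] by simp
qed

lemma flat_sharp:
  assumes d: "d \<in> hom \<Z> (L\<^bsub>A\<^esub> \<cdot>\<^sub>o x) z" and x: "x \<in> Ob \<X>"
  shows "flat z (R\<^bsub>A\<^esub> \<cdot>\<^sub>m d \<odot>\<^bsub>\<X>\<^esub> \<eta>\<^bsub>A\<^esub> x) = d"
proof -
  note z = left.cod.hom_Cod_in[OF d]
  note Rd = right.fmor_in[OF d] and e = counit_in[OF z] and u = unit_in[OF x]
  have "flat z (R\<^bsub>A\<^esub> \<cdot>\<^sub>m d \<odot>\<^bsub>\<X>\<^esub> \<eta>\<^bsub>A\<^esub> x)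
      = d \<odot>\<^bsub>\<Z>\<^esub> \<epsilon>\<^bsub>A\<^esub> (L\<^bsub>A\<^esub> \<cdot>\<^sub>o x) \<odot>\<^bsub>\<Z>\<^esub> L\<^bsub>A\<^esub> \<cdot>\<^sub>m \<eta>\<^bsub>A\<^esub> x"
    using left.fmor_Comp[OF u Rd] counit_natural[OF d]
      left.cod.Comp_assoc[OF left.fmor_in[OF u] left.fmor_in[OF Rd] e] by simp
  then show ?thesis
    using left.cod.Comp_inverse_cancel_right[OF counit_in[OF left.fob_in[OF x]]
        left.fmor_in[OF u] d triangle_left[OF x]] by simp
qed

lemma flat_inject:
  assumes "f \<in> hom \<X> x (R\<^bsub>A\<^esub> \<cdot>\<^sub>o z)" "f' \<in> hom \<X> x (R\<^bsub>A\<^esub> \<cdot>\<^sub>o z)" "z \<in> Ob \<Z>"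
  shows "flat z f = flat z f' \<longleftrightarrow> f = f'"
  using sharp_flat[OF assms(1,3)] sharp_flat[OF assms(2,3)] by metis

lemma Comp_flat:
  assumes "f \<in> hom \<X> x (R\<^bsub>A\<^esub> \<cdot>\<^sub>o z)" "h \<in> hom \<Z> z z'"
  shows "h \<odot>\<^bsub>\<Z>\<^esub> flat z f = flat z' (R\<^bsub>A\<^esub> \<cdot>\<^sub>m h \<odot>\<^bsub>\<X>\<^esub> f)"
proof -
  note ob = left.cod.hom_Dom_in[OF assms(2)] left.cod.hom_Cod_in[OF assms(2)]
  note Lf = left.fmor_in[OF assms(1)] and Rh = right.fmor_in[OF assms(2)]
  show ?thesis
    using left.cod.Comp_assoc[OF Lf counit_in[OF ob(1)] assms(2)] counit_natural[OF assms(2)]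
      left.cod.Comp_assoc[OF Lf left.fmor_in[OF Rh] counit_in[OF ob(2)]]
      left.fmor_Comp[OF assms(1) Rh] by simp
qed

text \<open>Each of the four conditions on a cocone under \<open>\<Delta>(X)\<close> has the left-hand form, for a suitable
  choice of adjunction, of \<open>k\<close> among \<open>\<rho>, \<sigma>, v, w\<close>, and of a leg \<open>e\<close>; transposition turns it into a
  condition on morphisms into \<open>R z\<close>. Both sides become equations between transposes because
  \<open>e \<odot> \<epsilon> = \<epsilon> \<odot> L (R e)\<close>.\<close>
lemma flat_square_iff:
  assumes f: "f \<in> hom \<X> x (R\<^bsub>A\<^esub> \<cdot>\<^sub>o z)" and k: "k \<in> hom \<X> (R\<^bsub>A\<^esub> \<cdot>\<^sub>o z') x"
    and e: "e \<in> hom \<Z> z' z"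
  shows "flat z f \<odot>\<^bsub>\<Z>\<^esub> L\<^bsub>A\<^esub> \<cdot>\<^sub>m k = e \<odot>\<^bsub>\<Z>\<^esub> \<epsilon>\<^bsub>A\<^esub> z' \<longleftrightarrow> f \<odot>\<^bsub>\<X>\<^esub> k = R\<^bsub>A\<^esub> \<cdot>\<^sub>m e"
proof -
  note z = left.cod.hom_Cod_in[OF e]
  have "flat z f \<odot>\<^bsub>\<Z>\<^esub> L\<^bsub>A\<^esub> \<cdot>\<^sub>m k = flat z (f \<odot>\<^bsub>\<X>\<^esub> k)"
    using left.cod.Comp_assoc[OF left.fmor_in[OF k] left.fmor_in[OF f] counit_in[OF z]]
      left.fmor_Comp[OF k f] by simp
  moreover have "e \<odot>\<^bsub>\<Z>\<^esub> \<epsilon>\<^bsub>A\<^esub> z' = flat z (R\<^bsub>A\<^esub> \<cdot>\<^sub>m e)"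
    using counit_natural[OF e] by simp
  ultimately show ?thesis
    using flat_inject[OF left.dom.Comp_in[OF k f] right.fmor_in[OF e] z] by simp
qed

text \<open>The usual split coequaliser presenting an algebra, with splittings \<open>\<eta>\<^sub>x\<close> of \<open>\<rho>\<close> and \<open>\<eta>\<close> at
  \<open>R (L x)\<close> of the multiplication; an arrow \<open>e\<close> coequalising the pair factors through \<open>e \<odot> \<eta>\<^sub>x\<close>.\<close>
lemma algebra_coequaliser:
  assumes "is_algebra \<X> (adj_monad A) (x, \<rho>)"
  shows "is_coequaliser \<X> (R\<^bsub>A\<^esub> \<cdot>\<^sub>m L\<^bsub>A\<^esub> \<cdot>\<^sub>m \<rho>) (R\<^bsub>A\<^esub> \<cdot>\<^sub>m \<epsilon>\<^bsub>A\<^esub> (L\<^bsub>A\<^esub> \<cdot>\<^sub>o x)) \<rho>"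
proof -
  let ?TT = "R\<^bsub>A\<^esub> \<cdot>\<^sub>o L\<^bsub>A\<^esub> \<cdot>\<^sub>o R\<^bsub>A\<^esub> \<cdot>\<^sub>o L\<^bsub>A\<^esub> \<cdot>\<^sub>o x" and ?T = "R\<^bsub>A\<^esub> \<cdot>\<^sub>o L\<^bsub>A\<^esub> \<cdot>\<^sub>o x"
  let ?p = "R\<^bsub>A\<^esub> \<cdot>\<^sub>m L\<^bsub>A\<^esub> \<cdot>\<^sub>m \<rho>" and ?q = "R\<^bsub>A\<^esub> \<cdot>\<^sub>m \<epsilon>\<^bsub>A\<^esub> (L\<^bsub>A\<^esub> \<cdot>\<^sub>o x)"
  have x: "x \<in> Ob \<X>" and r: "\<rho> \<in> hom \<X> ?T x" and sq: "\<rho> \<odot>\<^bsub>\<X>\<^esub> ?p = \<rho> \<odot>\<^bsub>\<X>\<^esub> ?q"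
    and sec: "\<rho> \<odot>\<^bsub>\<X>\<^esub> \<eta>\<^bsub>A\<^esub> x = Id \<X> x"
    using assms by (simp_all add: is_algebra_def adj_monad_def comp_functor_def)
  note Lx = left.fob_in[OF x]
  note Tx = right.fob_in[OF Lx]
  have p: "?p \<in> hom \<X> ?TT ?T" and q: "?q \<in> hom \<X> ?TT ?T"
    using right.fmor_in[OF left.fmor_in[OF r]] right.fmor_in[OF counit_in[OF Lx]] .
  note u = unit_in[OF x] and v = unit_in[OF Tx]
  have "\<exists>!h. h \<in> hom \<X> x c \<and> h \<odot>\<^bsub>\<X>\<^esub> \<rho> = e"
    if e: "e \<in> hom \<X> ?T c" "e \<odot>\<^bsub>\<X>\<^esub> ?p = e \<odot>\<^bsub>\<X>\<^esub> ?q" for c e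
  proof (rule ex1I)
    have "e \<odot>\<^bsub>\<X>\<^esub> \<eta>\<^bsub>A\<^esub> x \<odot>\<^bsub>\<X>\<^esub> \<rho> = e \<odot>\<^bsub>\<X>\<^esub> (?p \<odot>\<^bsub>\<X>\<^esub> \<eta>\<^bsub>A\<^esub> ?T)"
      using left.dom.Comp_assoc[OF r u e(1)] unit_natural[OF r] by simp
    also have "\<dots> = e \<odot>\<^bsub>\<X>\<^esub> (?q \<odot>\<^bsub>\<X>\<^esub> \<eta>\<^bsub>A\<^esub> ?T)"
      using left.dom.Comp_assoc[OF v p e(1)] left.dom.Comp_assoc[OF v q e(1)] e(2) by simp
    also have "\<dots> = e"
      using triangle_right[OF Lx] left.dom.Comp_Id_right[OF e(1)] by simp
    finally show "e \<odot>\<^bsub>\<X>\<^esub> \<eta>\<^bsub>A\<^esub> x \<in> hom \<X> x c \<and> e \<odot>\<^bsub>\<X>\<^esub> \<eta>\<^bsub>A\<^esub> x \<odot>\<^bsub>\<X>\<^esub> \<rho> = e"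
      using left.dom.Comp_in[OF u e(1)] by simp
    show "h = e \<odot>\<^bsub>\<X>\<^esub> \<eta>\<^bsub>A\<^esub> x" if "h \<in> hom \<X> x c \<and> h \<odot>\<^bsub>\<X>\<^esub> \<rho> = e" for h
      using left.dom.Comp_inverse_cancel_right[OF r u _ sec, of h c] that by simp
  qed
  then show ?thesis using left.dom.is_coequaliser_iff[OF p q r] sq by simp
qed

end

section \<open>The Eilenberg--Moore category and the comparison functor\<close>

lemma EM_hom_iff:
  "(f, g) \<in> EM_hom \<X> \<Y> A B ((x, \<rho>), (y, \<sigma>), v, w) ((x', \<rho>'), (y', \<sigma>'), v', w') \<longleftrightarrow>
     f \<in> hom \<X> x x' \<and> g \<in> hom \<Y> y y' \<and>
     f \<odot>\<^bsub>\<X>\<^esub> \<rho> = \<rho>' \<odot>\<^bsub>\<X>\<^esub> R\<^bsub>A\<^esub> \<cdot>\<^sub>m L\<^bsub>A\<^esub> \<cdot>\<^sub>m f \<and> g \<odot>\<^bsub>\<Y>\<^esub> \<sigma> = \<sigma>' \<odot>\<^bsub>\<Y>\<^esub> R\<^bsub>B\<^esub> \<cdot>\<^sub>m L\<^bsub>B\<^esub> \<cdot>\<^sub>m g \<and>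
     g \<odot>\<^bsub>\<Y>\<^esub> w = w' \<odot>\<^bsub>\<Y>\<^esub> R\<^bsub>B\<^esub> \<cdot>\<^sub>m L\<^bsub>A\<^esub> \<cdot>\<^sub>m f \<and> f \<odot>\<^bsub>\<X>\<^esub> v = v' \<odot>\<^bsub>\<X>\<^esub> R\<^bsub>A\<^esub> \<cdot>\<^sub>m L\<^bsub>B\<^esub> \<cdot>\<^sub>m g"
  by (auto simp: EM_hom_def alg_hom_def adj_monad_def comp_functor_def)

lemma EM_Ob_D:
  assumes "((x, \<rho>), (y, \<sigma>), v, w) \<in> EM_Ob \<X> \<Y> A B"
  shows "x \<in> Ob \<X>" "y \<in> Ob \<Y>"
    and "\<rho> \<in> hom \<X> (R\<^bsub>A\<^esub> \<cdot>\<^sub>o L\<^bsub>A\<^esub> \<cdot>\<^sub>o x) x" "\<sigma> \<in> hom \<Y> (R\<^bsub>B\<^esub> \<cdot>\<^sub>o L\<^bsub>B\<^esub> \<cdot>\<^sub>o y) y"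
    and "v \<in> hom \<X> (R\<^bsub>A\<^esub> \<cdot>\<^sub>o L\<^bsub>B\<^esub> \<cdot>\<^sub>o y) x" "w \<in> hom \<Y> (R\<^bsub>B\<^esub> \<cdot>\<^sub>o L\<^bsub>A\<^esub> \<cdot>\<^sub>o x) y"
    and "is_algebra \<X> (adj_monad A) (x, \<rho>)" "is_algebra \<Y> (adj_monad B) (y, \<sigma>)"
  using assms by (auto simp: EM_Ob_def is_algebra_def adj_monad_def comp_functor_def)

lemma EM_simps [simp]:
  "Ob (EM \<X> \<Y> A B) = EM_Ob \<X> \<Y> A B"
  "Mor (EM \<X> \<Y> A B) =
     {(p, q, h). p \<in> EM_Ob \<X> \<Y> A B \<and> q \<in> EM_Ob \<X> \<Y> A B \<and> h \<in> EM_hom \<X> \<Y> A B p q}"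
  "(p, q, h) \<in> hom (EM \<X> \<Y> A B) p' q' \<longleftrightarrow> p = p' \<and> q = q' \<and>
     p \<in> EM_Ob \<X> \<Y> A B \<and> q \<in> EM_Ob \<X> \<Y> A B \<and> h \<in> EM_hom \<X> \<Y> A B p q"
  "Id (EM \<X> \<Y> A B) ((x, \<rho>), (y, \<sigma>), v, w)
     = (((x, \<rho>), (y, \<sigma>), v, w), ((x, \<rho>), (y, \<sigma>), v, w), (Id \<X> x, Id \<Y> y))"
  "Comp (EM \<X> \<Y> A B) (q', r, (f', g')) (p, q, (f, g)) = (p, r, (f' \<odot>\<^bsub>\<X>\<^esub> f, g' \<odot>\<^bsub>\<Y>\<^esub> g))"
  by (auto simp: EM_def hom_def)

lemma EM_homE:
  assumes "t \<in> hom (EM \<X> \<Y> A B) p q"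
  obtains f g x \<rho> y \<sigma> v w x' \<rho>' y' \<sigma>' v' w' where "t = (p, q, (f, g))"
    "p = ((x, \<rho>), (y, \<sigma>), v, w)" "q = ((x', \<rho>'), (y', \<sigma>'), v', w')"
    "p \<in> EM_Ob \<X> \<Y> A B" "q \<in> EM_Ob \<X> \<Y> A B" "(f, g) \<in> EM_hom \<X> \<Y> A B p q"
proof -
  obtain f g where "t = (p, q, (f, g))" "p \<in> EM_Ob \<X> \<Y> A B" "q \<in> EM_Ob \<X> \<Y> A B"
    "(f, g) \<in> EM_hom \<X> \<Y> A B p q"
    using assms by (cases t) (auto simp: EM_def hom_def)
  then show thesis using that by (metis surj_pair)
qed

context double_adjunction begin

lemmas RLAA = adjA.right.fmor_in[OF adjA.left.fmor_in]
  and RLAB = adjA.right.fmor_in[OF adjB.left.fmor_in]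
  and RLBA = adjB.right.fmor_in[OF adjA.left.fmor_in]
  and RLBB = adjB.right.fmor_in[OF adjB.left.fmor_in]

lemma RL_Comp:
  assumes "f \<in> hom \<X> x x'" "f' \<in> hom \<X> x' x''"
  shows "R\<^bsub>A\<^esub> \<cdot>\<^sub>m L\<^bsub>A\<^esub> \<cdot>\<^sub>m (f' \<odot>\<^bsub>\<X>\<^esub> f) = R\<^bsub>A\<^esub> \<cdot>\<^sub>m L\<^bsub>A\<^esub> \<cdot>\<^sub>m f' \<odot>\<^bsub>\<X>\<^esub> R\<^bsub>A\<^esub> \<cdot>\<^sub>m L\<^bsub>A\<^esub> \<cdot>\<^sub>m f"
    "R\<^bsub>B\<^esub> \<cdot>\<^sub>m L\<^bsub>A\<^esub> \<cdot>\<^sub>m (f' \<odot>\<^bsub>\<X>\<^esub> f) = R\<^bsub>B\<^esub> \<cdot>\<^sub>m L\<^bsub>A\<^esub> \<cdot>\<^sub>m f' \<odot>\<^bsub>\<Y>\<^esub> R\<^bsub>B\<^esub> \<cdot>\<^sub>m L\<^bsub>A\<^esub> \<cdot>\<^sub>m f"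
  using adjA.left.fmor_Comp[OF assms]
    adjA.right.fmor_Comp[OF adjA.left.fmor_in[OF assms(1)] adjA.left.fmor_in[OF assms(2)]]
    adjB.right.fmor_Comp[OF adjA.left.fmor_in[OF assms(1)] adjA.left.fmor_in[OF assms(2)]]
  by simp_all

lemma RL_Id:
  assumes "x \<in> Ob \<X>"
  shows "R\<^bsub>A\<^esub> \<cdot>\<^sub>m L\<^bsub>A\<^esub> \<cdot>\<^sub>m Id \<X> x = Id \<X> (R\<^bsub>A\<^esub> \<cdot>\<^sub>o L\<^bsub>A\<^esub> \<cdot>\<^sub>o x)"
    "R\<^bsub>B\<^esub> \<cdot>\<^sub>m L\<^bsub>A\<^esub> \<cdot>\<^sub>m Id \<X> x = Id \<Y> (R\<^bsub>B\<^esub> \<cdot>\<^sub>o L\<^bsub>A\<^esub> \<cdot>\<^sub>o x)"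
  using adjA.left.fmor_Id[OF assms] adjA.right.fmor_Id[OF adjA.left.fob_in[OF assms]]
    adjB.right.fmor_Id[OF adjA.left.fob_in[OF assms]] by simp_all

lemma double_adjunction_swap: "double_adjunction \<Y> \<X> \<Z> B A"
  by (simp add: double_adjunction_def adjA.adjunction_axioms adjB.adjunction_axioms)

lemmas RL_Comp' = double_adjunction.RL_Comp[OF double_adjunction_swap]
  and RL_Id' = double_adjunction.RL_Id[OF double_adjunction_swap]

lemma EM_hom_Id:
  assumes "((x, \<rho>), (y, \<sigma>), v, w) \<in> EM_Ob \<X> \<Y> A B"
  shows "(Id \<X> x, Id \<Y> y)
    \<in> EM_hom \<X> \<Y> A B ((x, \<rho>), (y, \<sigma>), v, w) ((x, \<rho>), (y, \<sigma>), v, w)"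
  using EM_Ob_D[OF assms] unfolding EM_hom_iff
  by (simp add: RL_Id RL_Id' adjA.left.dom.Id_in adjB.left.dom.Id_in
      adjA.left.dom.Comp_Id_left adjA.left.dom.Comp_Id_right
      adjB.left.dom.Comp_Id_left adjB.left.dom.Comp_Id_right)

lemma EM_hom_Comp:
  assumes p: "((x, \<rho>), (y, \<sigma>), v, w) \<in> EM_Ob \<X> \<Y> A B"
    and q: "((x', \<rho>'), (y', \<sigma>'), v', w') \<in> EM_Ob \<X> \<Y> A B"
    and r: "((x'', \<rho>''), (y'', \<sigma>''), v'', w'') \<in> EM_Ob \<X> \<Y> A B"
    and fg: "(f, g) \<in> EM_hom \<X> \<Y> A B ((x, \<rho>), (y, \<sigma>), v, w) ((x', \<rho>'), (y', \<sigma>'), v', w')"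
    and fg': "(f', g')
      \<in> EM_hom \<X> \<Y> A B ((x', \<rho>'), (y', \<sigma>'), v', w') ((x'', \<rho>''), (y'', \<sigma>''), v'', w'')"
  shows "(f' \<odot>\<^bsub>\<X>\<^esub> f, g' \<odot>\<^bsub>\<Y>\<^esub> g)
    \<in> EM_hom \<X> \<Y> A B ((x, \<rho>), (y, \<sigma>), v, w) ((x'', \<rho>''), (y'', \<sigma>''), v'', w'')"
proof -
  have f: "f \<in> hom \<X> x x'" "f' \<in> hom \<X> x' x''" and g: "g \<in> hom \<Y> y y'" "g' \<in> hom \<Y> y' y''"
    using fg fg' by (simp_all add: EM_hom_iff)
  note P = EM_Ob_D[OF p] and Q = EM_Ob_D[OF q] and R = EM_Ob_D[OF r]
  note pasteX = adjA.left.dom.square_paste and pasteY = adjB.left.dom.square_paste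
  show ?thesis
    unfolding EM_hom_iff RL_Comp[OF f] RL_Comp'[OF g]
    using adjA.left.dom.Comp_in[OF f] adjB.left.dom.Comp_in[OF g]
      pasteX[OF RLAA[OF f(1)] RLAA[OF f(2)] P(3) Q(3) R(3) f]
      pasteX[OF RLAB[OF g(1)] RLAB[OF g(2)] P(5) Q(5) R(5) f]
      pasteY[OF RLBB[OF g(1)] RLBB[OF g(2)] P(4) Q(4) R(4) g]
      pasteY[OF RLBA[OF f(1)] RLBA[OF f(2)] P(6) Q(6) R(6) g]
      fg fg'
    by (simp add: EM_hom_iff)
qed

lemma category_EM: "category (EM \<X> \<Y> A B)"
proof
  fix t p q assume t: "t \<in> hom (EM \<X> \<Y> A B) p q"
  obtain f g x \<rho> y \<sigma> v w x' \<rho>' y' \<sigma>' v' w' where T: "t = (p, q, (f, g))"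
    "p = ((x, \<rho>), (y, \<sigma>), v, w)" "q = ((x', \<rho>'), (y', \<sigma>'), v', w')"
    "p \<in> EM_Ob \<X> \<Y> A B" "q \<in> EM_Ob \<X> \<Y> A B" "(f, g) \<in> EM_hom \<X> \<Y> A B p q"
    using EM_homE[OF t] .
  have f: "f \<in> hom \<X> x x'" and g: "g \<in> hom \<Y> y y'"
    using T by (simp_all add: EM_hom_iff)
  show "Id (EM \<X> \<Y> A B) q \<odot>\<^bsub>EM \<X> \<Y> A B\<^esub> t = t" "t \<odot>\<^bsub>EM \<X> \<Y> A B\<^esub> Id (EM \<X> \<Y> A B) p = t"
    using T(1-3) adjA.left.dom.Comp_Id_left[OF f] adjA.left.dom.Comp_Id_right[OF f]
      adjB.left.dom.Comp_Id_left[OF g] adjB.left.dom.Comp_Id_right[OF g] by simp_all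
  fix t' r assume t': "t' \<in> hom (EM \<X> \<Y> A B) q r"
  obtain f' g' x'' \<rho>'' y'' \<sigma>'' v'' w'' where T': "t' = (q, r, (f', g'))"
    "r = ((x'', \<rho>''), (y'', \<sigma>''), v'', w'')" "r \<in> EM_Ob \<X> \<Y> A B"
    "(f', g') \<in> EM_hom \<X> \<Y> A B q r"
    using EM_homE[OF t'] by metis
  have f': "f' \<in> hom \<X> x' x''" and g': "g' \<in> hom \<Y> y' y''"
    using T(3) T' by (simp_all add: EM_hom_iff)
  show "t' \<odot>\<^bsub>EM \<X> \<Y> A B\<^esub> t \<in> hom (EM \<X> \<Y> A B) p r"
    using EM_hom_Comp[of x \<rho> y \<sigma> v w x' \<rho>' y' \<sigma>' v' w' x'' \<rho>'' y'' \<sigma>'' v'' w'' f g f' g'] T T'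
    by simp
  fix t'' s assume t'': "t'' \<in> hom (EM \<X> \<Y> A B) r s"
  obtain f'' g'' x3 \<rho>3 y3 \<sigma>3 v3 w3 where T'': "t'' = (r, s, (f'', g''))"
    "s = ((x3, \<rho>3), (y3, \<sigma>3), v3, w3)" "s \<in> EM_Ob \<X> \<Y> A B"
    "(f'', g'') \<in> EM_hom \<X> \<Y> A B r s"
    using EM_homE[OF t''] by metis
  have f'': "f'' \<in> hom \<X> x'' x3" and g'': "g'' \<in> hom \<Y> y'' y3"
    using T'(2) T'' by (simp_all add: EM_hom_iff)
  show "t'' \<odot>\<^bsub>EM \<X> \<Y> A B\<^esub> t' \<odot>\<^bsub>EM \<X> \<Y> A B\<^esub> t
      = t'' \<odot>\<^bsub>EM \<X> \<Y> A B\<^esub> (t' \<odot>\<^bsub>EM \<X> \<Y> A B\<^esub> t)"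
    using T(1) T'(1) T''(1) adjA.left.dom.Comp_assoc[OF f f' f'']
      adjB.left.dom.Comp_assoc[OF g g' g''] by simp
next
  fix p assume "p \<in> Ob (EM \<X> \<Y> A B)"
  then show "Id (EM \<X> \<Y> A B) p \<in> hom (EM \<X> \<Y> A B) p p"
    using EM_hom_Id by (cases p) auto
qed (auto simp: EM_def)

text \<open>All six compatibility conditions of \<open>K z\<close>, and the associativity of its two algebras, are images
  under \<open>R\<^sub>A\<close> or \<open>R\<^sub>B\<close> of naturality of a counit, taken at a morphism that is itself a counit. The
  unit laws of the algebras are triangle identities.\<close>
lemma comparison_ob_in:
  assumes z: "z \<in> Ob \<Z>"
  shows "comparison_ob A B z \<in> EM_Ob \<X> \<Y> A B"
proof -
  note a = adjA.counit_in[OF z] and b = adjB.counit_in[OF z]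
  note Lza = adjA.left.cod.hom_Dom_in[OF a] and Lzb = adjA.left.cod.hom_Dom_in[OF b]
  have push: "R\<^bsub>A\<^esub> \<cdot>\<^sub>m h \<odot>\<^bsub>\<X>\<^esub> R\<^bsub>A\<^esub> \<cdot>\<^sub>m \<epsilon>\<^bsub>A\<^esub> c = R\<^bsub>A\<^esub> \<cdot>\<^sub>m \<epsilon>\<^bsub>A\<^esub> z \<odot>\<^bsub>\<X>\<^esub> R\<^bsub>A\<^esub> \<cdot>\<^sub>m L\<^bsub>A\<^esub> \<cdot>\<^sub>m R\<^bsub>A\<^esub> \<cdot>\<^sub>m h"
      "R\<^bsub>A\<^esub> \<cdot>\<^sub>m h \<odot>\<^bsub>\<X>\<^esub> R\<^bsub>A\<^esub> \<cdot>\<^sub>m \<epsilon>\<^bsub>B\<^esub> c = R\<^bsub>A\<^esub> \<cdot>\<^sub>m \<epsilon>\<^bsub>B\<^esub> z \<odot>\<^bsub>\<X>\<^esub> R\<^bsub>A\<^esub> \<cdot>\<^sub>m L\<^bsub>B\<^esub> \<cdot>\<^sub>m R\<^bsub>B\<^esub> \<cdot>\<^sub>m h"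
      "R\<^bsub>B\<^esub> \<cdot>\<^sub>m h \<odot>\<^bsub>\<Y>\<^esub> R\<^bsub>B\<^esub> \<cdot>\<^sub>m \<epsilon>\<^bsub>A\<^esub> c = R\<^bsub>B\<^esub> \<cdot>\<^sub>m \<epsilon>\<^bsub>A\<^esub> z \<odot>\<^bsub>\<Y>\<^esub> R\<^bsub>B\<^esub> \<cdot>\<^sub>m L\<^bsub>A\<^esub> \<cdot>\<^sub>m R\<^bsub>A\<^esub> \<cdot>\<^sub>m h"
      "R\<^bsub>B\<^esub> \<cdot>\<^sub>m h \<odot>\<^bsub>\<Y>\<^esub> R\<^bsub>B\<^esub> \<cdot>\<^sub>m \<epsilon>\<^bsub>B\<^esub> c = R\<^bsub>B\<^esub> \<cdot>\<^sub>m \<epsilon>\<^bsub>B\<^esub> z \<odot>\<^bsub>\<Y>\<^esub> R\<^bsub>B\<^esub> \<cdot>\<^sub>m L\<^bsub>B\<^esub> \<cdot>\<^sub>m R\<^bsub>B\<^esub> \<cdot>\<^sub>m h"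
    if h: "h \<in> hom \<Z> c z" for h c
  proof -
    note c = adjA.left.cod.hom_Dom_in[OF h]
    note ca = adjA.counit_in[OF c] and cb = adjB.counit_in[OF c]
    note La = adjA.left.fmor_in[OF adjA.right.fmor_in[OF h]]
      and Lb = adjB.left.fmor_in[OF adjB.right.fmor_in[OF h]]
    show "R\<^bsub>A\<^esub> \<cdot>\<^sub>m h \<odot>\<^bsub>\<X>\<^esub> R\<^bsub>A\<^esub> \<cdot>\<^sub>m \<epsilon>\<^bsub>A\<^esub> c = R\<^bsub>A\<^esub> \<cdot>\<^sub>m \<epsilon>\<^bsub>A\<^esub> z \<odot>\<^bsub>\<X>\<^esub> R\<^bsub>A\<^esub> \<cdot>\<^sub>m L\<^bsub>A\<^esub> \<cdot>\<^sub>m R\<^bsub>A\<^esub> \<cdot>\<^sub>m h"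
      "R\<^bsub>B\<^esub> \<cdot>\<^sub>m h \<odot>\<^bsub>\<Y>\<^esub> R\<^bsub>B\<^esub> \<cdot>\<^sub>m \<epsilon>\<^bsub>A\<^esub> c = R\<^bsub>B\<^esub> \<cdot>\<^sub>m \<epsilon>\<^bsub>A\<^esub> z \<odot>\<^bsub>\<Y>\<^esub> R\<^bsub>B\<^esub> \<cdot>\<^sub>m L\<^bsub>A\<^esub> \<cdot>\<^sub>m R\<^bsub>A\<^esub> \<cdot>\<^sub>m h"
      using adjA.counit_natural[OF h] adjA.right.fmor_Comp[OF La a] adjA.right.fmor_Comp[OF ca h]
        adjB.right.fmor_Comp[OF La a] adjB.right.fmor_Comp[OF ca h] by simp_all
    show "R\<^bsub>A\<^esub> \<cdot>\<^sub>m h \<odot>\<^bsub>\<X>\<^esub> R\<^bsub>A\<^esub> \<cdot>\<^sub>m \<epsilon>\<^bsub>B\<^esub> c = R\<^bsub>A\<^esub> \<cdot>\<^sub>m \<epsilon>\<^bsub>B\<^esub> z \<odot>\<^bsub>\<X>\<^esub> R\<^bsub>A\<^esub> \<cdot>\<^sub>m L\<^bsub>B\<^esub> \<cdot>\<^sub>m R\<^bsub>B\<^esub> \<cdot>\<^sub>m h"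
      "R\<^bsub>B\<^esub> \<cdot>\<^sub>m h \<odot>\<^bsub>\<Y>\<^esub> R\<^bsub>B\<^esub> \<cdot>\<^sub>m \<epsilon>\<^bsub>B\<^esub> c = R\<^bsub>B\<^esub> \<cdot>\<^sub>m \<epsilon>\<^bsub>B\<^esub> z \<odot>\<^bsub>\<Y>\<^esub> R\<^bsub>B\<^esub> \<cdot>\<^sub>m L\<^bsub>B\<^esub> \<cdot>\<^sub>m R\<^bsub>B\<^esub> \<cdot>\<^sub>m h"
      using adjB.counit_natural[OF h] adjA.right.fmor_Comp[OF Lb b] adjA.right.fmor_Comp[OF cb h]
        adjB.right.fmor_Comp[OF Lb b] adjB.right.fmor_Comp[OF cb h] by simp_all
  qed
  show ?thesis
    using push[OF a] push[OF b] adjA.right.fob_in[OF z] adjB.right.fob_in[OF z]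
      adjA.right.fmor_in[OF a] adjA.right.fmor_in[OF b] adjB.right.fmor_in[OF a]
      adjB.right.fmor_in[OF b] adjA.triangle_right[OF z] adjB.triangle_right[OF z]
    by (simp add: comparison_ob_def EM_Ob_def is_algebra_def adj_monad_def comp_functor_def)
qed

lemma comparison_mor_in:
  assumes h: "h \<in> hom \<Z> z z'"
  shows "(R\<^bsub>A\<^esub> \<cdot>\<^sub>m h, R\<^bsub>B\<^esub> \<cdot>\<^sub>m h) \<in> EM_hom \<X> \<Y> A B (comparison_ob A B z) (comparison_ob A B z')"
proof -
  note ob = adjA.left.cod.hom_Dom_in[OF h] adjA.left.cod.hom_Cod_in[OF h]
  note La = adjA.left.fmor_in[OF adjA.right.fmor_in[OF h]]
    and Lb = adjB.left.fmor_in[OF adjB.right.fmor_in[OF h]]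
  note a = adjA.counit_in[OF ob(1)] adjA.counit_in[OF ob(2)]
    and b = adjB.counit_in[OF ob(1)] adjB.counit_in[OF ob(2)]
  show ?thesis
    unfolding comparison_ob_def EM_hom_iff
    using adjA.right.fmor_in[OF h] adjB.right.fmor_in[OF h]
      adjA.counit_natural[OF h] adjB.counit_natural[OF h]
      adjA.right.fmor_Comp[OF La a(2)] adjA.right.fmor_Comp[OF a(1) h]
      adjB.right.fmor_Comp[OF La a(2)] adjB.right.fmor_Comp[OF a(1) h]
      adjA.right.fmor_Comp[OF Lb b(2)] adjA.right.fmor_Comp[OF b(1) h]
      adjB.right.fmor_Comp[OF Lb b(2)] adjB.right.fmor_Comp[OF b(1) h]
    by simp
qed

lemma fob_comparison [simp]: "comparison \<Z> A B \<cdot>\<^sub>o z = comparison_ob A B z"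
  by (simp add: comparison_def)

lemma fmor_comparison:
  "h \<in> hom \<Z> z z' \<Longrightarrow> comparison \<Z> A B \<cdot>\<^sub>m h
     = (comparison_ob A B z, comparison_ob A B z', (R\<^bsub>A\<^esub> \<cdot>\<^sub>m h, R\<^bsub>B\<^esub> \<cdot>\<^sub>m h))"
  by (simp add: comparison_def hom_def)

lemma cfunctor_comparison: "cfunctor \<Z> (EM \<X> \<Y> A B) (comparison \<Z> A B)"
proof (intro cfunctor.intro cfunctor_axioms.intro)
  show "category \<Z>" by (rule adjA.left.cod.category_axioms)
  show "category (EM \<X> \<Y> A B)" by (rule category_EM)
  fix z assume z: "z \<in> Ob \<Z>"
  show "comparison \<Z> A B \<cdot>\<^sub>o z \<in> Ob (EM \<X> \<Y> A B)"
    using comparison_ob_in[OF z] by simp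
  show "comparison \<Z> A B \<cdot>\<^sub>m Id \<Z> z = Id (EM \<X> \<Y> A B) (comparison \<Z> A B \<cdot>\<^sub>o z)"
    using fmor_comparison[OF adjA.left.cod.Id_in[OF z]] adjA.right.fmor_Id[OF z]
      adjB.right.fmor_Id[OF z] by (simp add: comparison_ob_def)
next
  fix f z z' assume f: "f \<in> hom \<Z> z z'"
  show "comparison \<Z> A B \<cdot>\<^sub>m f
      \<in> hom (EM \<X> \<Y> A B) (comparison \<Z> A B \<cdot>\<^sub>o z) (comparison \<Z> A B \<cdot>\<^sub>o z')"
    using fmor_comparison[OF f] comparison_mor_in[OF f] comparison_ob_in
      adjA.left.cod.hom_Dom_in[OF f] adjA.left.cod.hom_Cod_in[OF f] by simp
  fix g z'' assume g: "g \<in> hom \<Z> z' z''"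
  show "comparison \<Z> A B \<cdot>\<^sub>m (g \<odot>\<^bsub>\<Z>\<^esub> f)
      = comparison \<Z> A B \<cdot>\<^sub>m g \<odot>\<^bsub>EM \<X> \<Y> A B\<^esub> comparison \<Z> A B \<cdot>\<^sub>m f"
    using fmor_comparison[OF adjA.left.cod.Comp_in[OF f g]] fmor_comparison[OF f]
      fmor_comparison[OF g] adjA.right.fmor_Comp[OF f g] adjB.right.fmor_Comp[OF f g] by simp
qed

sublocale EM: category "EM \<X> \<Y> A B" by (rule category_EM)
sublocale K: cfunctor \<Z> "EM \<X> \<Y> A B" "comparison \<Z> A B" by (rule cfunctor_comparison)

text \<open>The inverses of the components satisfy the compatibility conditions automatically, since each
  condition is a commuting square that can be inverted.\<close>
lemma EM_iso_iff:
  assumes "(p, q, (f, g)) \<in> hom (EM \<X> \<Y> A B) p q"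
  shows "is_iso (EM \<X> \<Y> A B) (p, q, (f, g)) \<longleftrightarrow> is_iso \<X> f \<and> is_iso \<Y> g"
proof -
  obtain x \<rho> y \<sigma> v w x' \<rho>' y' \<sigma>' v' w' where
    p: "p = ((x, \<rho>), (y, \<sigma>), v, w)" and q: "q = ((x', \<rho>'), (y', \<sigma>'), v', w')"
    by (metis surj_pair)
  have ob: "p \<in> EM_Ob \<X> \<Y> A B" "q \<in> EM_Ob \<X> \<Y> A B" and fg: "(f, g) \<in> EM_hom \<X> \<Y> A B p q"
    using assms by simp_all
  have f: "f \<in> hom \<X> x x'" and g: "g \<in> hom \<Y> y y'"
    using fg by (simp_all add: EM_hom_iff p q)
  note P = EM_Ob_D[OF ob(1)[unfolded p]] and Q = EM_Ob_D[OF ob(2)[unfolded q]]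
  show ?thesis
  proof
    assume "is_iso (EM \<X> \<Y> A B) (p, q, (f, g))"
    then obtain t where t: "t \<in> hom (EM \<X> \<Y> A B) q p"
      "t \<odot>\<^bsub>EM \<X> \<Y> A B\<^esub> (p, q, (f, g)) = Id (EM \<X> \<Y> A B) p"
      "(p, q, (f, g)) \<odot>\<^bsub>EM \<X> \<Y> A B\<^esub> t = Id (EM \<X> \<Y> A B) q"
      using EM.is_iso_iff[OF assms] by blast
    obtain f' g' where t': "t = (q, p, (f', g'))" "(f', g') \<in> EM_hom \<X> \<Y> A B q p"
      using EM_homE[OF t(1)] by metis
    have "f' \<in> hom \<X> x' x" "g' \<in> hom \<Y> y' y" using t'(2) by (simp_all add: EM_hom_iff p q)
    then show "is_iso \<X> f \<and> is_iso \<Y> g"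
      using adjA.left.dom.is_isoI[OF f] adjB.left.dom.is_isoI[OF g] t(2,3)
      by (simp add: t'(1) p q)
  next
    assume iso: "is_iso \<X> f \<and> is_iso \<Y> g"
    obtain f' where f': "f' \<in> hom \<X> x' x" "f' \<odot>\<^bsub>\<X>\<^esub> f = Id \<X> x" "f \<odot>\<^bsub>\<X>\<^esub> f' = Id \<X> x'"
      using adjA.left.dom.is_isoE[OF conjunct1[OF iso] f] .
    obtain g' where g': "g' \<in> hom \<Y> y' y" "g' \<odot>\<^bsub>\<Y>\<^esub> g = Id \<Y> y" "g \<odot>\<^bsub>\<Y>\<^esub> g' = Id \<Y> y'"
      using adjB.left.dom.is_isoE[OF conjunct2[OF iso] g] .
    have T: "R\<^bsub>A\<^esub> \<cdot>\<^sub>m L\<^bsub>A\<^esub> \<cdot>\<^sub>m f \<odot>\<^bsub>\<X>\<^esub> R\<^bsub>A\<^esub> \<cdot>\<^sub>m L\<^bsub>A\<^esub> \<cdot>\<^sub>m f' = Id \<X> (R\<^bsub>A\<^esub> \<cdot>\<^sub>o L\<^bsub>A\<^esub> \<cdot>\<^sub>o x')"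
      "R\<^bsub>B\<^esub> \<cdot>\<^sub>m L\<^bsub>A\<^esub> \<cdot>\<^sub>m f \<odot>\<^bsub>\<Y>\<^esub> R\<^bsub>B\<^esub> \<cdot>\<^sub>m L\<^bsub>A\<^esub> \<cdot>\<^sub>m f' = Id \<Y> (R\<^bsub>B\<^esub> \<cdot>\<^sub>o L\<^bsub>A\<^esub> \<cdot>\<^sub>o x')"
      "R\<^bsub>B\<^esub> \<cdot>\<^sub>m L\<^bsub>B\<^esub> \<cdot>\<^sub>m g \<odot>\<^bsub>\<Y>\<^esub> R\<^bsub>B\<^esub> \<cdot>\<^sub>m L\<^bsub>B\<^esub> \<cdot>\<^sub>m g' = Id \<Y> (R\<^bsub>B\<^esub> \<cdot>\<^sub>o L\<^bsub>B\<^esub> \<cdot>\<^sub>o y')"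
      "R\<^bsub>A\<^esub> \<cdot>\<^sub>m L\<^bsub>B\<^esub> \<cdot>\<^sub>m g \<odot>\<^bsub>\<X>\<^esub> R\<^bsub>A\<^esub> \<cdot>\<^sub>m L\<^bsub>B\<^esub> \<cdot>\<^sub>m g' = Id \<X> (R\<^bsub>A\<^esub> \<cdot>\<^sub>o L\<^bsub>B\<^esub> \<cdot>\<^sub>o y')"
      using RL_Comp[OF f'(1) f] RL_Comp'[OF g'(1) g] RL_Id[OF Q(1)] RL_Id'[OF Q(2)] f'(3) g'(3)
      by simp_all
    have "(f', g') \<in> EM_hom \<X> \<Y> A B q p"
      using adjA.left.dom.square_inverse[OF RLAA[OF f] RLAA[OF f'(1)] P(3) Q(3) f f'(1,2) T(1)]
        adjB.left.dom.square_inverse[OF RLBA[OF f] RLBA[OF f'(1)] P(6) Q(6) g g'(1,2) T(2)]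
        adjB.left.dom.square_inverse[OF RLBB[OF g] RLBB[OF g'(1)] P(4) Q(4) g g'(1,2) T(3)]
        adjA.left.dom.square_inverse[OF RLAB[OF g] RLAB[OF g'(1)] P(5) Q(5) f f'(1,2) T(4)]
        f'(1) g'(1) fg
      unfolding p q EM_hom_iff by simp
    then show "is_iso (EM \<X> \<Y> A B) (p, q, (f, g))"
      using EM.is_isoI[OF assms, of "(q, p, (f', g'))"] ob f' g' by (simp add: p q)
  qed
qed

lemma reflects_isos_iff:
  "reflects_isos \<X> \<Y> \<Z> A B \<longleftrightarrow>
     (\<forall>h \<in> Mor \<Z>. is_iso (EM \<X> \<Y> A B) (comparison \<Z> A B \<cdot>\<^sub>m h) \<longrightarrow> is_iso \<Z> h)"
proof -
  have "is_iso (EM \<X> \<Y> A B) (comparison \<Z> A B \<cdot>\<^sub>m h) \<longleftrightarrow>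
      is_iso \<X> (R\<^bsub>A\<^esub> \<cdot>\<^sub>m h) \<and> is_iso \<Y> (R\<^bsub>B\<^esub> \<cdot>\<^sub>m h)" if "h \<in> Mor \<Z>" for h
  proof -
    have h: "h \<in> hom \<Z> (Dom \<Z> h) (Cod \<Z> h)" using that by (simp add: hom_def)
    show ?thesis using EM_iso_iff K.fmor_in[OF h] unfolding fmor_comparison[OF h] by simp
  qed
  then show ?thesis unfolding reflects_isos_def by blast
qed

section \<open>Colimits of \<open>\<Delta>(X)\<close> as universal arrows\<close>

text \<open>The cocone under \<open>\<Delta>(X)\<close> whose legs at \<open>L\<^sub>A X\<close> and \<open>L\<^sub>B Y\<close> are the transposes of \<open>f\<close> and \<open>g\<close>. The
  other four vertices are sources of two arrows each; the leg is written as the composite with the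
  counit among them, and the cocone condition says that the second arrow gives the same.\<close>
definition delta_cocone ::
  "('xo, 'xm, 'yo, 'ym) em_ob \<Rightarrow> 'zo \<Rightarrow> 'xm \<times> 'ym \<Rightarrow> delta_vert \<Rightarrow> 'zm" where
  "delta_cocone = (\<lambda>((x, \<rho>), (y, \<sigma>), v, w) z (f, g) i.
     let dA = \<epsilon>\<^bsub>A\<^esub> z \<odot>\<^bsub>\<Z>\<^esub> L\<^bsub>A\<^esub> \<cdot>\<^sub>m f; dB = \<epsilon>\<^bsub>B\<^esub> z \<odot>\<^bsub>\<Z>\<^esub> L\<^bsub>B\<^esub> \<cdot>\<^sub>m g in
     case i of V_LA \<Rightarrow> dA | V_LB \<Rightarrow> dB
       | V_LRL_AA \<Rightarrow> dA \<odot>\<^bsub>\<Z>\<^esub> \<epsilon>\<^bsub>A\<^esub> (L\<^bsub>A\<^esub> \<cdot>\<^sub>o x) | V_LRL_BA \<Rightarrow> dA \<odot>\<^bsub>\<Z>\<^esub> \<epsilon>\<^bsub>B\<^esub> (L\<^bsub>A\<^esub> \<cdot>\<^sub>o x)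
       | V_LRL_AB \<Rightarrow> dB \<odot>\<^bsub>\<Z>\<^esub> \<epsilon>\<^bsub>A\<^esub> (L\<^bsub>B\<^esub> \<cdot>\<^sub>o y) | V_LRL_BB \<Rightarrow> dB \<odot>\<^bsub>\<Z>\<^esub> \<epsilon>\<^bsub>B\<^esub> (L\<^bsub>B\<^esub> \<cdot>\<^sub>o y))"

lemma all_delta_vert: "(\<forall>i :: delta_vert. P i) \<longleftrightarrow>
    P V_LRL_AA \<and> P V_LRL_BA \<and> P V_LRL_AB \<and> P V_LRL_BB \<and> P V_LA \<and> P V_LB"
  by (metis delta_vert.exhaust)

lemma all_delta_edge: "(\<forall>e :: delta_edge. P e) \<longleftrightarrow>
    P E_LA_rho \<and> P E_epsA_LA \<and> P E_epsB_LA \<and> P E_LB_w \<and>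
    P E_epsA_LB \<and> P E_LA_v \<and> P E_epsB_LB \<and> P E_LB_rho"
  by (metis delta_edge.exhaust)

text \<open>Under transposition the four conditions for a morphism \<open>X \<rightarrow> K z\<close> are the four conditions for a
  cocone with vertex \<open>z\<close>.\<close>
lemma EM_hom_comparison_iff:
  assumes p: "((x, \<rho>), (y, \<sigma>), v, w) \<in> EM_Ob \<X> \<Y> A B" and z: "z \<in> Ob \<Z>"
    and f: "f \<in> hom \<X> x (R\<^bsub>A\<^esub> \<cdot>\<^sub>o z)" and g: "g \<in> hom \<Y> y (R\<^bsub>B\<^esub> \<cdot>\<^sub>o z)"
  shows "(f, g) \<in> EM_hom \<X> \<Y> A B ((x, \<rho>), (y, \<sigma>), v, w) (comparison_ob A B z) \<longleftrightarrow>
     adjA.flat z f \<odot>\<^bsub>\<Z>\<^esub> L\<^bsub>A\<^esub> \<cdot>\<^sub>m \<rho> = adjA.flat z f \<odot>\<^bsub>\<Z>\<^esub> \<epsilon>\<^bsub>A\<^esub> (L\<^bsub>A\<^esub> \<cdot>\<^sub>o x) \<and>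
     adjB.flat z g \<odot>\<^bsub>\<Z>\<^esub> L\<^bsub>B\<^esub> \<cdot>\<^sub>m w = adjA.flat z f \<odot>\<^bsub>\<Z>\<^esub> \<epsilon>\<^bsub>B\<^esub> (L\<^bsub>A\<^esub> \<cdot>\<^sub>o x) \<and>
     adjA.flat z f \<odot>\<^bsub>\<Z>\<^esub> L\<^bsub>A\<^esub> \<cdot>\<^sub>m v = adjB.flat z g \<odot>\<^bsub>\<Z>\<^esub> \<epsilon>\<^bsub>A\<^esub> (L\<^bsub>B\<^esub> \<cdot>\<^sub>o y) \<and>
     adjB.flat z g \<odot>\<^bsub>\<Z>\<^esub> L\<^bsub>B\<^esub> \<cdot>\<^sub>m \<sigma> = adjB.flat z g \<odot>\<^bsub>\<Z>\<^esub> \<epsilon>\<^bsub>B\<^esub> (L\<^bsub>B\<^esub> \<cdot>\<^sub>o y)"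
proof -
  note P = EM_Ob_D[OF p]
  note dA = adjA.flat_in[OF f z] and dB = adjB.flat_in[OF g z]
  note Lf = adjA.left.fmor_in[OF f] and Lg = adjB.left.fmor_in[OF g]
  note a = adjA.counit_in[OF z] and b = adjB.counit_in[OF z]
  show ?thesis
    unfolding comparison_ob_def EM_hom_iff
      adjA.flat_square_iff[OF f P(3) dA] adjB.flat_square_iff[OF g P(6) dA]
      adjA.flat_square_iff[OF f P(5) dB] adjB.flat_square_iff[OF g P(4) dB]
      adjA.right.fmor_Comp[OF Lf a] adjA.right.fmor_Comp[OF Lg b]
      adjB.right.fmor_Comp[OF Lf a] adjB.right.fmor_Comp[OF Lg b]
    using f g by blast
qed

text \<open>Cocones under \<open>\<Delta>(X)\<close> with vertex \<open>z\<close> are the same as morphisms \<open>X \<rightarrow> K z\<close>: a cocone is determined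
  by its legs at \<open>L\<^sub>A X\<close> and \<open>L\<^sub>B Y\<close>, whose transposes are the components of the morphism.\<close>
lemma is_cocone_Delta_iff:
  assumes p: "p \<in> EM_Ob \<X> \<Y> A B"
  shows "is_cocone \<Z> (Delta A B p) z d \<longleftrightarrow> z \<in> Ob \<Z> \<and>
    (\<exists>t \<in> EM_hom \<X> \<Y> A B p (comparison_ob A B z). d = delta_cocone p z t)"
proof -
  obtain x \<rho> y \<sigma> v w where p': "p = ((x, \<rho>), (y, \<sigma>), v, w)" by (metis surj_pair)
  note P = EM_Ob_D[OF p[unfolded p']]
  note LA = adjA.left.fob_in[OF P(1)] and LB = adjB.left.fob_in[OF P(2)]
  note ho = adjA.left.cod.Comp_in
  show ?thesis
  proof (intro iffI; (elim conjE bexE)?)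
    assume c: "is_cocone \<Z> (Delta A B p) z d"
    then have z: "z \<in> Ob \<Z>" by (simp add: is_cocone_def)
    have d: "d V_LA \<in> hom \<Z> (L\<^bsub>A\<^esub> \<cdot>\<^sub>o x) z" "d V_LB \<in> hom \<Z> (L\<^bsub>B\<^esub> \<cdot>\<^sub>o y) z"
      and e: "d V_LA \<odot>\<^bsub>\<Z>\<^esub> L\<^bsub>A\<^esub> \<cdot>\<^sub>m \<rho> = d V_LRL_AA" "d V_LA \<odot>\<^bsub>\<Z>\<^esub> \<epsilon>\<^bsub>A\<^esub> (L\<^bsub>A\<^esub> \<cdot>\<^sub>o x) = d V_LRL_AA"
        "d V_LA \<odot>\<^bsub>\<Z>\<^esub> \<epsilon>\<^bsub>B\<^esub> (L\<^bsub>A\<^esub> \<cdot>\<^sub>o x) = d V_LRL_BA" "d V_LB \<odot>\<^bsub>\<Z>\<^esub> L\<^bsub>B\<^esub> \<cdot>\<^sub>m w = d V_LRL_BA"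
        "d V_LB \<odot>\<^bsub>\<Z>\<^esub> \<epsilon>\<^bsub>A\<^esub> (L\<^bsub>B\<^esub> \<cdot>\<^sub>o y) = d V_LRL_AB" "d V_LA \<odot>\<^bsub>\<Z>\<^esub> L\<^bsub>A\<^esub> \<cdot>\<^sub>m v = d V_LRL_AB"
        "d V_LB \<odot>\<^bsub>\<Z>\<^esub> \<epsilon>\<^bsub>B\<^esub> (L\<^bsub>B\<^esub> \<cdot>\<^sub>o y) = d V_LRL_BB" "d V_LB \<odot>\<^bsub>\<Z>\<^esub> L\<^bsub>B\<^esub> \<cdot>\<^sub>m \<sigma> = d V_LRL_BB"
      using c by (simp_all add: is_cocone_def p' Delta_def all_delta_vert all_delta_edge)
    define f where "f = R\<^bsub>A\<^esub> \<cdot>\<^sub>m d V_LA \<odot>\<^bsub>\<X>\<^esub> \<eta>\<^bsub>A\<^esub> x"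
    define g where "g = R\<^bsub>B\<^esub> \<cdot>\<^sub>m d V_LB \<odot>\<^bsub>\<Y>\<^esub> \<eta>\<^bsub>B\<^esub> y"
    have f: "f \<in> hom \<X> x (R\<^bsub>A\<^esub> \<cdot>\<^sub>o z)" "adjA.flat z f = d V_LA"
      unfolding f_def
      using adjA.left.dom.Comp_in[OF adjA.unit_in[OF P(1)] adjA.right.fmor_in[OF d(1)]]
        adjA.flat_sharp[OF d(1) P(1)] by blast+
    have g: "g \<in> hom \<Y> y (R\<^bsub>B\<^esub> \<cdot>\<^sub>o z)" "adjB.flat z g = d V_LB"
      unfolding g_def
      using adjB.left.dom.Comp_in[OF adjB.unit_in[OF P(2)] adjB.right.fmor_in[OF d(2)]]
        adjB.flat_sharp[OF d(2) P(2)] by blast+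
    have "(f, g) \<in> EM_hom \<X> \<Y> A B p (comparison_ob A B z)"
      unfolding p' EM_hom_comparison_iff[OF p[unfolded p'] z f(1) g(1)] f(2) g(2) e by blast
    moreover have "d = delta_cocone p z (f, g)"
      by (simp add: fun_eq_iff all_delta_vert delta_cocone_def p' f(2) g(2) e)
    ultimately show "z \<in> Ob \<Z> \<and>
        (\<exists>t \<in> EM_hom \<X> \<Y> A B p (comparison_ob A B z). d = delta_cocone p z t)"
      using z by blast
  next
    fix t assume z: "z \<in> Ob \<Z>" and t: "t \<in> EM_hom \<X> \<Y> A B p (comparison_ob A B z)"
      and d: "d = delta_cocone p z t"
    obtain f g where t': "t = (f, g)" by force
    have f: "f \<in> hom \<X> x (R\<^bsub>A\<^esub> \<cdot>\<^sub>o z)" and g: "g \<in> hom \<Y> y (R\<^bsub>B\<^esub> \<cdot>\<^sub>o z)"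
      using t by (simp_all add: t' p' comparison_ob_def EM_hom_iff)
    note dA = adjA.flat_in[OF f z] and dB = adjB.flat_in[OF g z]
    show "is_cocone \<Z> (Delta A B p) z d"
      using t[unfolded t' p' EM_hom_comparison_iff[OF p[unfolded p'] z f g]] z dA dB
        ho[OF adjA.counit_in[OF LA] dA] ho[OF adjB.counit_in[OF LA] dA]
        ho[OF adjA.counit_in[OF LB] dB] ho[OF adjB.counit_in[OF LB] dB]
      by (simp add: is_cocone_def p' t' d delta_cocone_def Delta_def all_delta_vert all_delta_edge)
  qed
qed

text \<open>The correspondence between cocones and morphisms into \<open>K\<close> is natural in the vertex, so mediating
  morphisms of cocones are factorisations through \<open>K\<close>.\<close>
lemma Comp_delta_cocone_iff:
  assumes p: "p \<in> EM_Ob \<X> \<Y> A B" and h: "h \<in> hom \<Z> z z'"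
    and t: "(f, g) \<in> EM_hom \<X> \<Y> A B p (comparison_ob A B z)"
    and t': "(f', g') \<in> EM_hom \<X> \<Y> A B p (comparison_ob A B z')"
  shows "(\<forall>i. h \<odot>\<^bsub>\<Z>\<^esub> delta_cocone p z (f, g) i = delta_cocone p z' (f', g') i) \<longleftrightarrow>
    R\<^bsub>A\<^esub> \<cdot>\<^sub>m h \<odot>\<^bsub>\<X>\<^esub> f = f' \<and> R\<^bsub>B\<^esub> \<cdot>\<^sub>m h \<odot>\<^bsub>\<Y>\<^esub> g = g'"
proof -
  obtain x \<rho> y \<sigma> v w where p': "p = ((x, \<rho>), (y, \<sigma>), v, w)" by (metis surj_pair)
  note P = EM_Ob_D[OF p[unfolded p']]
  note ob = adjA.left.cod.hom_Dom_in[OF h] adjA.left.cod.hom_Cod_in[OF h]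
  have f: "f \<in> hom \<X> x (R\<^bsub>A\<^esub> \<cdot>\<^sub>o z)" "f' \<in> hom \<X> x (R\<^bsub>A\<^esub> \<cdot>\<^sub>o z')"
    and g: "g \<in> hom \<Y> y (R\<^bsub>B\<^esub> \<cdot>\<^sub>o z)" "g' \<in> hom \<Y> y (R\<^bsub>B\<^esub> \<cdot>\<^sub>o z')"
    using t t' by (simp_all add: p' comparison_ob_def EM_hom_iff)
  note dA = adjA.flat_in[OF f(1) ob(1)] and dB = adjB.flat_in[OF g(1) ob(1)]
  note LA = adjA.left.fob_in[OF P(1)] and LB = adjB.left.fob_in[OF P(2)]
  note assoc = adjA.left.cod.Comp_assoc[OF _ _ h, symmetric]
  have "(\<forall>i. h \<odot>\<^bsub>\<Z>\<^esub> delta_cocone p z (f, g) i = delta_cocone p z' (f', g') i) \<longleftrightarrow>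
      h \<odot>\<^bsub>\<Z>\<^esub> adjA.flat z f = adjA.flat z' f' \<and> h \<odot>\<^bsub>\<Z>\<^esub> adjB.flat z g = adjB.flat z' g'"
    using assoc[OF adjA.counit_in[OF LA] dA] assoc[OF adjB.counit_in[OF LA] dA]
      assoc[OF adjA.counit_in[OF LB] dB] assoc[OF adjB.counit_in[OF LB] dB]
    by (auto simp: delta_cocone_def p' all_delta_vert)
  also have "\<dots> \<longleftrightarrow> R\<^bsub>A\<^esub> \<cdot>\<^sub>m h \<odot>\<^bsub>\<X>\<^esub> f = f' \<and> R\<^bsub>B\<^esub> \<cdot>\<^sub>m h \<odot>\<^bsub>\<Y>\<^esub> g = g'"
    unfolding adjA.Comp_flat[OF f(1) h] adjB.Comp_flat[OF g(1) h]
      adjA.flat_inject[OF adjA.left.dom.Comp_in[OF f(1) adjA.right.fmor_in[OF h]] f(2) ob(2)]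
      adjB.flat_inject[OF adjB.left.dom.Comp_in[OF g(1) adjB.right.fmor_in[OF h]] g(2) ob(2)] ..
  finally show ?thesis .
qed

text \<open>Morphisms of the Eilenberg--Moore category carry their source and target; this attaches them to
  a bare pair of components.\<close>
abbreviation EM_arrow ::
  "('xo, 'xm, 'yo, 'ym) em_ob \<Rightarrow> 'zo \<Rightarrow> 'xm \<times> 'ym
    \<Rightarrow> ('xo, 'xm, 'yo, 'ym) em_ob \<times> ('xo, 'xm, 'yo, 'ym) em_ob \<times> ('xm \<times> 'ym)" where
  "EM_arrow p z t \<equiv> (p, comparison_ob A B z, t)"

text \<open>Since cocones correspond naturally to morphisms into \<open>K\<close>, an initial cocone is a universal arrow
  from \<open>X\<close> to \<open>K\<close>. Existence of the colimits thus means that \<open>K\<close> has a left adjoint.\<close>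
lemma is_colimit_Delta_iff:
  assumes p: "p \<in> EM_Ob \<X> \<Y> A B"
  shows "is_colimit \<Z> (Delta A B p) z d \<longleftrightarrow>
    (\<exists>t. universal_arrow \<Z> (EM \<X> \<Y> A B) (comparison \<Z> A B) p z (EM_arrow p z t) \<and>
      d = delta_cocone p z t)"
proof -
  let ?H = "\<lambda>z. EM_hom \<X> \<Y> A B p (comparison_ob A B z)"
  have vert: "Vert (Delta A B p) = UNIV" by (auto simp: Delta_def split: prod.split)
  have factor: "h \<in> hom \<Z> z z' \<and> (\<forall>i \<in> UNIV. h \<odot>\<^bsub>\<Z>\<^esub> delta_cocone p z t i = delta_cocone p z' t' i)
      \<longleftrightarrow> h \<in> hom \<Z> z z' \<and>
        comparison \<Z> A B \<cdot>\<^sub>m h \<odot>\<^bsub>EM \<X> \<Y> A B\<^esub> EM_arrow p z t = EM_arrow p z' t'"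
    if "t \<in> ?H z" "t' \<in> ?H z'" for h z' t t'
    using Comp_delta_cocone_iff[OF p, of h z z' "fst t" "snd t" "fst t'" "snd t'"] that
    by (cases t; cases t') (auto simp: fmor_comparison)
  have cocones: "(\<forall>z' d'. is_cocone \<Z> (Delta A B p) z' d' \<longrightarrow> Q z' d') \<longleftrightarrow>
      (\<forall>z' \<in> Ob \<Z>. \<forall>t' \<in> ?H z'. Q z' (delta_cocone p z' t'))" for Q
    unfolding is_cocone_Delta_iff[OF p] by blast
  have arrows: "(\<forall>u \<in> hom (EM \<X> \<Y> A B) p (comparison_ob A B z'). Q u) \<longleftrightarrow>
      (\<forall>t' \<in> ?H z'. Q (EM_arrow p z' t'))" if "z' \<in> Ob \<Z>" for z' Q
    using p comparison_ob_in[OF that] by (fastforce simp: EM_def hom_def)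
  have universal: "universal_arrow \<Z> (EM \<X> \<Y> A B) (comparison \<Z> A B) p z (EM_arrow p z t) \<longleftrightarrow>
      z \<in> Ob \<Z> \<and> t \<in> ?H z \<and> (\<forall>z' \<in> Ob \<Z>. \<forall>t' \<in> ?H z'. \<exists>!h. h \<in> hom \<Z> z z' \<and>
        (\<forall>i \<in> UNIV. h \<odot>\<^bsub>\<Z>\<^esub> delta_cocone p z t i = delta_cocone p z' t' i))" for t
  proof -
    have "universal_arrow \<Z> (EM \<X> \<Y> A B) (comparison \<Z> A B) p z (EM_arrow p z t) \<longleftrightarrow>
        z \<in> Ob \<Z> \<and> t \<in> ?H z \<and> (\<forall>z' \<in> Ob \<Z>. \<forall>t' \<in> ?H z'. \<exists>!h. h \<in> hom \<Z> z z' \<and>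
          comparison \<Z> A B \<cdot>\<^sub>m h \<odot>\<^bsub>EM \<X> \<Y> A B\<^esub> EM_arrow p z t = EM_arrow p z' t')"
      using p comparison_ob_in unfolding universal_arrow_def fob_comparison
      by (simp add: arrows cong: conj_cong)
    then show ?thesis by (simp only: factor cong: conj_cong ball_cong)
  qed
  have "(z \<in> Ob \<Z> \<and> (\<exists>t \<in> ?H z. d = delta_cocone p z t)) \<and> Q d \<longleftrightarrow>
      (\<exists>t. (z \<in> Ob \<Z> \<and> t \<in> ?H z \<and> Q (delta_cocone p z t)) \<and> d = delta_cocone p z t)" for Q
    by blast
  then show ?thesis
    unfolding is_colimit_def vert cocones unfolding is_cocone_Delta_iff[OF p] universal .
qed

lemma has_Delta_colimits_iff:
  "has_Delta_colimits \<X> \<Y> \<Z> A B \<longleftrightarrow> (\<forall>p \<in> Ob (EM \<X> \<Y> A B). \<exists>z u.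
     universal_arrow \<Z> (EM \<X> \<Y> A B) (comparison \<Z> A B) p z u)"
proof -
  have "\<exists>t. u = EM_arrow p z t"
    if "universal_arrow \<Z> (EM \<X> \<Y> A B) (comparison \<Z> A B) p z u" for p z u
    using that by (cases u) (simp add: universal_arrow_def)
  then show ?thesis
    unfolding has_Delta_colimits_def using is_colimit_Delta_iff by (metis EM_simps(1))
qed

text \<open>As \<open>f\<close> is an algebra morphism into \<open>K z\<close>, applying \<open>R\<^sub>A\<close> to its transpose gives \<open>f \<odot> \<rho>\<close>. Now \<open>\<rho>\<close>
  is already a coequaliser of the pair in question, so \<open>f \<odot> \<rho>\<close> is one exactly when \<open>f\<close> is invertible.
  The same holds for \<open>g\<close>.\<close>
lemma coequaliser_delta_iff_iso:
  assumes p: "((x, \<rho>), (y, \<sigma>), v, w) \<in> EM_Ob \<X> \<Y> A B" (is "?p \<in> _") and z: "z \<in> Ob \<Z>"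
    and t: "(f, g) \<in> EM_hom \<X> \<Y> A B ((x, \<rho>), (y, \<sigma>), v, w) (comparison_ob A B z)"
  shows "is_coequaliser \<X> (R\<^bsub>A\<^esub> \<cdot>\<^sub>m L\<^bsub>A\<^esub> \<cdot>\<^sub>m \<rho>) (R\<^bsub>A\<^esub> \<cdot>\<^sub>m \<epsilon>\<^bsub>A\<^esub> (L\<^bsub>A\<^esub> \<cdot>\<^sub>o x))
      (R\<^bsub>A\<^esub> \<cdot>\<^sub>m delta_cocone ?p z (f, g) V_LA) \<longleftrightarrow> is_iso \<X> f" (is ?A)
    and "is_coequaliser \<Y> (R\<^bsub>B\<^esub> \<cdot>\<^sub>m L\<^bsub>B\<^esub> \<cdot>\<^sub>m \<sigma>) (R\<^bsub>B\<^esub> \<cdot>\<^sub>m \<epsilon>\<^bsub>B\<^esub> (L\<^bsub>B\<^esub> \<cdot>\<^sub>o y))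
      (R\<^bsub>B\<^esub> \<cdot>\<^sub>m delta_cocone ?p z (f, g) V_LB) \<longleftrightarrow> is_iso \<Y> g" (is ?B)
proof -
  note P = EM_Ob_D[OF p]
  have f: "f \<in> hom \<X> x (R\<^bsub>A\<^esub> \<cdot>\<^sub>o z)" and g: "g \<in> hom \<Y> y (R\<^bsub>B\<^esub> \<cdot>\<^sub>o z)"
    and alg: "f \<odot>\<^bsub>\<X>\<^esub> \<rho> = R\<^bsub>A\<^esub> \<cdot>\<^sub>m \<epsilon>\<^bsub>A\<^esub> z \<odot>\<^bsub>\<X>\<^esub> R\<^bsub>A\<^esub> \<cdot>\<^sub>m L\<^bsub>A\<^esub> \<cdot>\<^sub>m f"
      "g \<odot>\<^bsub>\<Y>\<^esub> \<sigma> = R\<^bsub>B\<^esub> \<cdot>\<^sub>m \<epsilon>\<^bsub>B\<^esub> z \<odot>\<^bsub>\<Y>\<^esub> R\<^bsub>B\<^esub> \<cdot>\<^sub>m L\<^bsub>B\<^esub> \<cdot>\<^sub>m g"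
    using t by (simp_all add: comparison_ob_def EM_hom_iff)
  have d: "R\<^bsub>A\<^esub> \<cdot>\<^sub>m delta_cocone ?p z (f, g) V_LA = f \<odot>\<^bsub>\<X>\<^esub> \<rho>"
    "R\<^bsub>B\<^esub> \<cdot>\<^sub>m delta_cocone ?p z (f, g) V_LB = g \<odot>\<^bsub>\<Y>\<^esub> \<sigma>"
    unfolding alg
    using adjA.right.fmor_Comp[OF adjA.left.fmor_in[OF f] adjA.counit_in[OF z]]
      adjB.right.fmor_Comp[OF adjB.left.fmor_in[OF g] adjB.counit_in[OF z]]
    by (simp_all add: delta_cocone_def)
  show ?A unfolding d
    using adjA.left.dom.coequaliser_Comp_iff_iso[OF RLAA[OF P(3)]
        adjA.right.fmor_in[OF adjA.counit_in[OF adjA.left.fob_in[OF P(1)]]] P(3) f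
        adjA.algebra_coequaliser[OF P(7)]] .
  show ?B unfolding d
    using adjB.left.dom.coequaliser_Comp_iff_iso[OF RLBB[OF P(4)]
        adjB.right.fmor_in[OF adjB.counit_in[OF adjB.left.fob_in[OF P(2)]]] P(4) g
        adjB.algebra_coequaliser[OF P(8)]] .
qed

text \<open>A universal arrow \<open>X \<rightarrow> K D\<close> is a pair of transposed colimit legs, and each leg is converted into
  a coequaliser exactly when the corresponding component of the arrow is invertible. Once all the
  colimits exist, the condition says that the unit of the adjunction between \<open>K\<close> and its left
  adjoint is an isomorphism.\<close>
lemma converts_colimits_iff:
  "converts_colimits \<X> \<Y> \<Z> A B \<longleftrightarrow> (\<forall>p \<in> Ob (EM \<X> \<Y> A B). \<forall>z u.
     universal_arrow \<Z> (EM \<X> \<Y> A B) (comparison \<Z> A B) p z u \<longrightarrow> is_iso (EM \<X> \<Y> A B) u)"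
  (is "_ \<longleftrightarrow> ?iso")
proof -
  let ?U = "universal_arrow \<Z> (EM \<X> \<Y> A B) (comparison \<Z> A B)"
  let ?converted = "\<lambda>x \<rho> y \<sigma> d.
      is_coequaliser \<X> (R\<^bsub>A\<^esub> \<cdot>\<^sub>m L\<^bsub>A\<^esub> \<cdot>\<^sub>m \<rho>) (R\<^bsub>A\<^esub> \<cdot>\<^sub>m \<epsilon>\<^bsub>A\<^esub> (L\<^bsub>A\<^esub> \<cdot>\<^sub>o x)) (R\<^bsub>A\<^esub> \<cdot>\<^sub>m d V_LA) \<and>
      is_coequaliser \<Y> (R\<^bsub>B\<^esub> \<cdot>\<^sub>m L\<^bsub>B\<^esub> \<cdot>\<^sub>m \<sigma>) (R\<^bsub>B\<^esub> \<cdot>\<^sub>m \<epsilon>\<^bsub>B\<^esub> (L\<^bsub>B\<^esub> \<cdot>\<^sub>o y)) (R\<^bsub>B\<^esub> \<cdot>\<^sub>m d V_LB)"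
  have conv: "?converted x \<rho> y \<sigma> (delta_cocone p z t) \<longleftrightarrow>
      is_iso (EM \<X> \<Y> A B) (EM_arrow p z t)"
    if p: "p = ((x, \<rho>), (y, \<sigma>), v, w)" and u: "?U p z (EM_arrow p z t)"
    for p x \<rho> y \<sigma> v w z t
  proof -
    obtain f g where t: "t = (f, g)" by force
    have z: "z \<in> Ob \<Z>" and u': "EM_arrow p z (f, g) \<in> hom (EM \<X> \<Y> A B) p (comparison_ob A B z)"
      using u by (simp_all add: universal_arrow_def t)
    then show ?thesis
      using EM_iso_iff[OF u'] coequaliser_delta_iff_iso[of x \<rho> y \<sigma> v w z f g] by (simp add: t p)
  qed
  show ?thesis
  proof
    assume c: "converts_colimits \<X> \<Y> \<Z> A B"
    show ?iso
    proof (intro ballI allI impI)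
      fix p z u assume p: "p \<in> Ob (EM \<X> \<Y> A B)" and u: "?U p z u"
      obtain x \<rho> y \<sigma> v w where p': "p = ((x, \<rho>), (y, \<sigma>), v, w)" by (metis surj_pair)
      obtain t where t: "u = EM_arrow p z t"
        using u by (cases u) (simp add: universal_arrow_def)
      have "is_colimit \<Z> (Delta A B p) z (delta_cocone p z t)"
        using is_colimit_Delta_iff[of p z] p u unfolding t EM_simps(1) by blast
      then have "?converted x \<rho> y \<sigma> (delta_cocone p z t)"
        using c p unfolding converts_colimits_def p' by blast
      then show "is_iso (EM \<X> \<Y> A B) u" using conv[OF p'] u unfolding t by blast
    qed
  next
    assume iso: ?iso
    show "converts_colimits \<X> \<Y> \<Z> A B"
      unfolding converts_colimits_def
    proof (intro allI impI)
      fix x \<rho> y \<sigma> v w z d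
      let ?p = "((x, \<rho>), (y, \<sigma>), v, w) :: ('xo, 'xm, 'yo, 'ym) em_ob"
      assume p: "?p \<in> Ob (EM \<X> \<Y> A B)" and "is_colimit \<Z> (Delta A B ?p) z d"
      then obtain t where t: "?U ?p z (EM_arrow ?p z t)" "d = delta_cocone ?p z t"
        using is_colimit_Delta_iff[of ?p z d] unfolding EM_simps(1) by blast
      then show "?converted x \<rho> y \<sigma> d" using conv[OF refl t(1)] iso p by blast
    qed
  qed
qed

end

section \<open>Moritability\<close>

theorem theorem3p6p7:
  fixes \<X> :: "('xo, 'xm) category" and \<Y> :: "('yo, 'ym) category"
    and \<Z> :: "('zo, 'zm) category"
    and A :: "('xo, 'xm, 'zo, 'zm) adj" and B :: "('yo, 'ym, 'zo, 'zm) adj"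
  assumes "double_adjunction \<X> \<Y> \<Z> A B"
  shows "moritable \<X> \<Y> \<Z> A B \<longleftrightarrow>
    has_Delta_colimits \<X> \<Y> \<Z> A B \<and> reflects_isos \<X> \<Y> \<Z> A B \<and> converts_colimits \<X> \<Y> \<Z> A B"
proof -
  interpret double_adjunction \<X> \<Y> \<Z> A B by fact
  show ?thesis
    unfolding moritable_def K.equivalence_iff_universal_isos has_Delta_colimits_iff
      reflects_isos_iff converts_colimits_iff ..
qed

end
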